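(* Let $c,d>0$ and let $\varphi_\beta:B^4(1/c^2)\to H^4(-d^2)$ be the rotationally symmetric, proper biharmonic conformal diffeomorphism defined by the function $$\beta(t)=\frac2d\tanh^{-1}(c^2e^t),\qquad t<\ln\left(\frac1{c^2}\right).$$ Then $\varphi_\beta$ is equivariant stable.
   Context: $B^4(1/c^2)$ is the open ball of radius $1/c^2$ centred at the origin in $\mathbb{R}^4$, and $H^4(-d^2)$ is the hyperbolic space of constant curvature $-d^2$, written in geodesic polar coordinates $(\theta,\alpha)$, $\theta\in S^3$, $\alpha\ge0$, with metric $h^2(\alpha)g_{S^3}+d\alpha^2$, $h(\alpha)=\frac1d\sinh(d\alpha)$. A rotationally symmetric map is of the form $(\theta,r)\mapsto(\theta,\alpha(r))$ in polar coordinates, with $\alpha(0)=0$; writing $r=e^t$ and $\beta(t)=\alpha(e^t)$, the map is denoted $\varphi_\beta$. A map is proper biharmonic if it is a critical point of the bienergy $\frac12\int|\tau(\varphi)|^2dv_g$, where $\tau(\varphi)=\operatorname{trace}\nabla d\varphi$, but $\tau(\varphi)\not\equiv0$. Up to an irrelevant positive constant factor, the bienergy of $\varphi_\beta$ is $$E_2(\varphi_\beta)=\frac12\int\left[\ddot\beta+2\dot\beta-3q(\beta)\right]^2dt,\qquad q(\beta)=h(\beta)h'(\beta),$$ the integral being over the domain of $\beta$ (when computing variations with compactly supported $V$, the integral is understood over compact sets containing the support of $V$). A critical point $\varphi_\beta$ is equivariant stable if $$\nabla^2E_2(\varphi_\beta)(\mathcal V,\mathcal V)=\frac{d^2E_2(\varphi_{\beta+sV})}{ds^2}\Big|_{s=0}>0$$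 for all smooth vector fields $\mathcal V=V(t)\,\partial/\partial\beta$ where $V$ is a real-valued, compactly supported smooth function on the domain of $\beta$, $V\not\equiv0$. *)

theory Defs
  imports "HOL-Analysis.Analysis"
begin

section \<open>Smooth maps\<close>

text \<open>\<open>C_k k S f\<close>: on the open set \<open>S\<close>, \<open>f\<close> is \<open>k\<close> times continuously differentiable
  (all iterated directional derivatives up to order \<open>k\<close> exist as Frechet derivatives and are
  continuous).\<close>

primrec C_k :: "nat \<Rightarrow> 'a::euclidean_space set \<Rightarrow> ('a \<Rightarrow> 'b::euclidean_space) \<Rightarrow> bool" where
  "C_k 0 S f \<longleftrightarrow> continuous_on S f"
| "C_k (Suc k) S f \<longleftrightarrow>
     (\<exists>f'. (\<forall>x\<in>S. (f has_derivative f' x) (at x)) \<and> (\<forall>v. C_k k S (\<lambda>x. f' x v)))"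

definition smooth_on :: "'a::euclidean_space set \<Rightarrow> ('a \<Rightarrow> 'b::euclidean_space) \<Rightarrow> bool" where
  "smooth_on S f \<longleftrightarrow> (\<forall>k. C_k k S f)"

text \<open>Smooth functions vanishing outside the compact set \<open>K\<close>. With \<open>K \<subseteq> \<Omega>\<close> and \<open>\<Omega>\<close> open, these
  are the smooth functions on \<open>\<Omega>\<close> with support contained in \<open>K\<close>, extended by zero.\<close>

definition test_function :: "'a::euclidean_space set \<Rightarrow> ('a \<Rightarrow> 'b::euclidean_space) \<Rightarrow> bool" where
  "test_function K V \<longleftrightarrow> compact K \<and> smooth_on UNIV V \<and> (\<forall>x. x \<notin> K \<longrightarrow> V x = 0)"

section \<open>Tension field and bienergy\<close>

text \<open>The domain is an open subset of Euclidean space; the target is covered by one chart with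
  values in \<open>real ^ 'n\<close>, in which its metric tensor is \<open>g\<close>.\<close>

definition partial :: "'m::finite \<Rightarrow> (real ^ 'm \<Rightarrow> real) \<Rightarrow> real ^ 'm \<Rightarrow> real" where
  "partial i f x = frechet_derivative f (at x) (axis i 1)"

definition christoffel ::
    "(real ^ 'n \<Rightarrow> real ^ 'n ^ 'n) \<Rightarrow> real ^ 'n \<Rightarrow> 'n::finite \<Rightarrow> 'n \<Rightarrow> 'n \<Rightarrow> real" where
  "christoffel g y k i j =
     1/2 * (\<Sum>l\<in>UNIV. matrix_inv (g y) $ k $ l *
        (partial i (\<lambda>z. g z $ j $ l) y + partial j (\<lambda>z. g z $ i $ l) y
           - partial l (\<lambda>z. g z $ i $ j) y))"

text \<open>\<open>\<tau>(\<phi>) = trace \<nabla>d\<phi>\<close> for a flat domain.\<close>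

definition tension ::
    "(real ^ 'n::finite \<Rightarrow> real ^ 'n ^ 'n) \<Rightarrow> (real ^ 'm::finite \<Rightarrow> real ^ 'n) \<Rightarrow> real ^ 'm \<Rightarrow> real ^ 'n"
  where
  "tension g \<phi> x = (\<chi> k. \<Sum>i\<in>UNIV.
      partial i (partial i (\<lambda>z. \<phi> z $ k)) x
      + (\<Sum>j\<in>UNIV. \<Sum>l\<in>UNIV. christoffel g (\<phi> x) k j l *
           partial i (\<lambda>z. \<phi> z $ j) x * partial i (\<lambda>z. \<phi> z $ l) x))"

definition metric_inner :: "(real ^ 'n \<Rightarrow> real ^ 'n ^ 'n) \<Rightarrow> real ^ 'n::finite \<Rightarrow> real ^ 'n \<Rightarrow> real ^ 'n \<Rightarrow> real"
  where "metric_inner g y v w = v \<bullet> (g y *v w)"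

definition bienergy ::
    "(real ^ 'n::finite \<Rightarrow> real ^ 'n ^ 'n) \<Rightarrow> (real ^ 'm::finite) set \<Rightarrow> (real ^ 'm \<Rightarrow> real ^ 'n) \<Rightarrow> real"
  where
  "bienergy g K \<phi> = 1/2 * integral K (\<lambda>x. metric_inner g (\<phi> x) (tension g \<phi> x) (tension g \<phi> x))"

text \<open>\<open>M\<close> is the open subset of \<open>real ^ 'n\<close> covered by the chart. A compactly supported section of the
  pull-back of the tangent bundle of the target is, in the chart, a compactly supported vector-valued
  function \<open>V\<close>; it is the velocity at \<open>s = 0\<close> of the variation \<open>\<phi> + s V\<close>, which stays in \<open>M\<close> for
  small \<open>\<bar>s\<bar>\<close>.\<close>

definition biharmonic ::
    "(real ^ 'n::finite \<Rightarrow> real ^ 'n ^ 'n) \<Rightarrow> (real ^ 'm::finite) set \<Rightarrow> (real ^ 'n) set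
      \<Rightarrow> (real ^ 'm \<Rightarrow> real ^ 'n) \<Rightarrow> bool"
  where
  "biharmonic g \<Omega> M \<phi> \<longleftrightarrow> smooth_on \<Omega> \<phi> \<and> \<phi> ` \<Omega> \<subseteq> M \<and>
     (\<forall>K V. K \<subseteq> \<Omega> \<longrightarrow> test_function K V \<longrightarrow>
        ((\<lambda>s. bienergy g K (\<lambda>x. \<phi> x + s *\<^sub>R V x)) has_real_derivative 0) (at 0))"

definition proper_biharmonic ::
    "(real ^ 'n::finite \<Rightarrow> real ^ 'n ^ 'n) \<Rightarrow> (real ^ 'm::finite) set \<Rightarrow> (real ^ 'n) set
      \<Rightarrow> (real ^ 'm \<Rightarrow> real ^ 'n) \<Rightarrow> bool"
  where
  "proper_biharmonic g \<Omega> M \<phi> \<longleftrightarrow> biharmonic g \<Omega> M \<phi> \<and> (\<exists>x\<in>\<Omega>. tension g \<phi> x \<noteq> 0)"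

definition conformal_diffeomorphism ::
    "(real ^ 'n::finite \<Rightarrow> real ^ 'n ^ 'n) \<Rightarrow> (real ^ 'm::finite) set \<Rightarrow> (real ^ 'n) set
      \<Rightarrow> (real ^ 'm \<Rightarrow> real ^ 'n) \<Rightarrow> bool"
  where
  "conformal_diffeomorphism g \<Omega> M \<phi> \<longleftrightarrow>
     bij_betw \<phi> \<Omega> M \<and> smooth_on \<Omega> \<phi> \<and> smooth_on M (inv_into \<Omega> \<phi>) \<and>
     (\<exists>\<rho>. \<forall>x\<in>\<Omega>. \<rho> x > 0 \<and>
        (\<forall>v w. metric_inner g (\<phi> x) (frechet_derivative \<phi> (at x) v) (frechet_derivative \<phi> (at x) w)
                = (\<rho> x)\<^sup>2 * (v \<bullet> w)))"

section \<open>Hyperbolic space\<close>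

text \<open>Poincare ball model of \<open>H\<^sup>4(-d\<^sup>2)\<close>: the open unit ball of \<open>real ^ 4\<close> with metric
  \<open>4 \<bar>dy\<bar>\<^sup>2 / (d\<^sup>2 (1 - \<bar>y\<bar>\<^sup>2)\<^sup>2)\<close>. The point with geodesic polar coordinates \<open>(\<theta>, \<alpha>)\<close> about the
  centre is \<open>tanh (d \<alpha> / 2) \<theta>\<close>.\<close>

definition hyp_space :: "(real ^ 4) set" where
  "hyp_space = ball 0 1"

definition hyp_metric :: "real \<Rightarrow> real ^ 4 \<Rightarrow> real ^ 4 ^ 4" where
  "hyp_metric d y = mat (4 / (d\<^sup>2 * (1 - (norm y)\<^sup>2)\<^sup>2))"

definition hyp_polar :: "real \<Rightarrow> real ^ 4 \<Rightarrow> real \<Rightarrow> real ^ 4" where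
  "hyp_polar d \<theta> \<alpha> = tanh (d * \<alpha> / 2) *\<^sub>R \<theta>"

definition hfun :: "real \<Rightarrow> real \<Rightarrow> real" where
  "hfun d \<alpha> = sinh (d * \<alpha>) / d"

text \<open>In these coordinates the metric is indeed \<open>h\<^sup>2(\<alpha>) g + d\<alpha>\<^sup>2\<close> with \<open>g\<close> the metric of the round
  unit sphere.\<close>

lemma hyp_metric_polar:
  fixes \<theta> :: "real \<Rightarrow> real ^ 4" and \<alpha> :: "real \<Rightarrow> real"
  assumes d: "d > 0" and sphere: "\<And>s. norm (\<theta> s) = 1"
    and \<theta>: "(\<theta> has_vector_derivative \<theta>') (at t)" and \<alpha>: "(\<alpha> has_real_derivative \<alpha>') (at t)"
  shows "\<exists>\<gamma>'. ((\<lambda>s. hyp_polar d (\<theta> s) (\<alpha> s)) has_vector_derivative \<gamma>') (at t) \<and>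
    metric_inner (hyp_metric d) (hyp_polar d (\<theta> t) (\<alpha> t)) \<gamma>' \<gamma>'
      = (hfun d (\<alpha> t))\<^sup>2 * (norm \<theta>')\<^sup>2 + \<alpha>'\<^sup>2"
proof -
  define T where "T = tanh (d * \<alpha> t / 2)"
  define a where "a = (1 - T\<^sup>2) * (d * \<alpha>' / 2)"
  define \<gamma>' where "\<gamma>' = a *\<^sub>R \<theta> t + T *\<^sub>R \<theta>'"
  have c0: "cosh x \<noteq> 0" for x :: real
    using cosh_real_pos[of x] by simp
  have T1: "((\<lambda>s. tanh (d * \<alpha> s / 2)) has_real_derivative a) (at t)"
    unfolding a_def T_def using c0
    by (auto intro!: derivative_eq_intros \<alpha>)
  have D: "((\<lambda>s. hyp_polar d (\<theta> s) (\<alpha> s)) has_vector_derivative \<gamma>') (at t)"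
    unfolding hyp_polar_def \<gamma>'_def
    using has_vector_derivative_scaleR[OF T1 \<theta>] by (simp add: T_def add.commute)
  have "((\<lambda>s. \<theta> s \<bullet> \<theta> s) has_vector_derivative (\<theta> t \<bullet> \<theta>' + \<theta>' \<bullet> \<theta> t)) (at t)"
    by (rule bounded_bilinear.has_vector_derivative[OF bounded_bilinear_inner \<theta> \<theta>])
  moreover have "(\<lambda>s. \<theta> s \<bullet> \<theta> s) = (\<lambda>s. 1)"
    using sphere by (simp add: dot_square_norm)
  ultimately have orth: "\<theta> t \<bullet> \<theta>' = 0"
    using vector_derivative_unique_at[of "\<lambda>s. 1" _ t 0] has_vector_derivative_const
    by (fastforce simp: inner_commute)
  have nn: "\<gamma>' \<bullet> \<gamma>' = a\<^sup>2 + T\<^sup>2 * (norm \<theta>')\<^sup>2"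
  proof -
    have "\<theta> t \<bullet> \<theta> t = 1" "\<theta>' \<bullet> \<theta>' = (norm \<theta>')\<^sup>2" "\<theta>' \<bullet> \<theta> t = 0"
      using sphere[of t] orth by (simp_all only: dot_square_norm inner_commute) simp
    with orth show ?thesis
      by (simp only: \<gamma>'_def inner_add_left inner_add_right inner_scaleR_left inner_scaleR_right)
         (simp add: power2_eq_square)
  qed
  have nT: "norm (hyp_polar d (\<theta> t) (\<alpha> t)) ^ 2 = T\<^sup>2"
    using sphere[of t] by (simp add: hyp_polar_def T_def)
  have mm: "metric_inner (hyp_metric d) (hyp_polar d (\<theta> t) (\<alpha> t)) \<gamma>' \<gamma>'
      = 4 / (d\<^sup>2 * (1 - T\<^sup>2)\<^sup>2) * (\<gamma>' \<bullet> \<gamma>')"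
    unfolding metric_inner_def hyp_metric_def nT
  proof -
    have *: "mat k *v v = k *\<^sub>R v" for k :: real and v :: "real ^ 4"
      by (simp add: vec_eq_iff matrix_vector_mult_def mat_def if_distrib[where f="\<lambda>x. x * _"] cong: if_cong)
    show "\<gamma>' \<bullet> (mat (4 / (d\<^sup>2 * (1 - T\<^sup>2)\<^sup>2)) *v \<gamma>') = 4 / (d\<^sup>2 * (1 - T\<^sup>2)\<^sup>2) * (\<gamma>' \<bullet> \<gamma>')"
      by (simp add: *)
  qed
  define C where "C = cosh (d * \<alpha> t / 2)"
  define S where "S = sinh (d * \<alpha> t / 2)"
  have C: "C \<noteq> 0" "C\<^sup>2 - S\<^sup>2 = 1"
    using c0 by (simp_all add: C_def S_def hyperbolic_pythagoras)
  have TS: "T = S / C" by (simp add: T_def S_def C_def tanh_def)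
  have oT: "1 - T\<^sup>2 = 1 / C\<^sup>2"
  proof -
    have "1 - T\<^sup>2 = (C\<^sup>2 - S\<^sup>2) / C\<^sup>2"
      using C(1) by (simp add: TS power_divide diff_divide_distrib)
    then show ?thesis by (simp only: C(2))
  qed
  have hS: "hfun d (\<alpha> t) = 2 * S * C / d"
    using sinh_double[of "d * \<alpha> t / 2"] by (simp add: hfun_def S_def C_def)
  have e1: "4 / (d\<^sup>2 * (1 - T\<^sup>2)\<^sup>2) * a\<^sup>2 = \<alpha>'\<^sup>2"
    using C(1) d unfolding a_def oT by (simp add: field_simps)
  have e2: "4 / (d\<^sup>2 * (1 - T\<^sup>2)\<^sup>2) * T\<^sup>2 = (hfun d (\<alpha> t))\<^sup>2"
    using C(1) d unfolding oT hS unfolding TS by (simp add: field_simps power2_eq_square)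
  have "4 / (d\<^sup>2 * (1 - T\<^sup>2)\<^sup>2) * (\<gamma>' \<bullet> \<gamma>') = (hfun d (\<alpha> t))\<^sup>2 * (norm \<theta>')\<^sup>2 + \<alpha>'\<^sup>2"
    using arg_cong[OF e2, of "\<lambda>z. z * (norm \<theta>')\<^sup>2"] e1
    by (simp only: nn distrib_left mult.assoc[symmetric])
  with D mm show ?thesis by auto
qed

section \<open>Rotationally symmetric maps\<close>

text \<open>\<open>\<phi>\<^sub>\<beta> : (\<theta>, r) \<mapsto> (\<theta>, \<beta> (ln r))\<close>, with the centre mapped to the centre.\<close>

definition rot_map :: "real \<Rightarrow> (real \<Rightarrow> real) \<Rightarrow> real ^ 4 \<Rightarrow> real ^ 4" where
  "rot_map d \<beta> x =
     (if x = 0 then 0 else hyp_polar d (x /\<^sub>R norm x) (\<beta> (ln (norm x))))"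

definition qfun :: "real \<Rightarrow> real \<Rightarrow> real" where
  "qfun d a = hfun d a * deriv (hfun d) a"

text \<open>The bienergy of \<open>\<phi>\<^sub>\<beta>\<close>, up to a positive constant factor, over the shells \<open>ln r \<in> K\<close>.\<close>

definition E2 :: "real \<Rightarrow> real set \<Rightarrow> (real \<Rightarrow> real) \<Rightarrow> real" where
  "E2 d K \<beta> = 1/2 * integral K (\<lambda>t. (deriv (deriv \<beta>) t + 2 * deriv \<beta> t - 3 * qfun d (\<beta> t))\<^sup>2)"

text \<open>\<open>F\<close> is twice differentiable at \<open>0\<close> and its second derivative there is positive.\<close>

definition second_deriv_pos :: "(real \<Rightarrow> real) \<Rightarrow> bool" where
  "second_deriv_pos F \<longleftrightarrow>
     (\<exists>F' D. (\<forall>\<^sub>F s in nhds 0. (F has_real_derivative F' s) (at s)) \<and>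
             (F' has_real_derivative D) (at 0) \<and> D > 0)"

text \<open>The map \<open>\<phi>\<^sub>\<beta>\<close> on the ball of radius \<open>R\<close>, with \<open>\<beta>\<close> defined for \<open>t < ln R\<close>, is a critical point of
  the bienergy (among all maps), and the second variation is positive in all nonzero equivariant
  directions.\<close>

definition equivariant_stable :: "real \<Rightarrow> real \<Rightarrow> (real \<Rightarrow> real) \<Rightarrow> bool" where
  "equivariant_stable d R \<beta> \<longleftrightarrow>
     biharmonic (hyp_metric d) (ball 0 R) hyp_space (rot_map d \<beta>) \<and>
     (\<forall>K V. K \<subseteq> {..<ln R} \<longrightarrow> test_function K V \<longrightarrow> (\<exists>t. V t \<noteq> 0) \<longrightarrow>
        second_deriv_pos (\<lambda>s. E2 d K (\<lambda>t. \<beta> t + s * V t)))"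

end

theory Submission
  imports Defs
begin

text \<open>In the Poincare ball model the map is as simple as possible. The point with geodesic polar
  coordinates \<open>(\<theta>, \<alpha>)\<close> is \<open>tanh (d \<alpha> / 2) \<theta>\<close>, so \<open>\<beta> t = 2 / d * artanh (c\<^sup>2 exp t)\<close> turns the
  rotationally symmetric map into the scaling \<open>x \<mapsto> a x\<close> with \<open>a = c\<^sup>2\<close>. It is a bijection between
  the two balls, and it is conformal because the hyperbolic metric is a multiple of the Euclidean
  one (\<open>conformal_diffeomorphism_scaling\<close>). Its tension field is \<open>- 4 a\<^sup>3 x / (1 - a\<^sup>2 |x|\<^sup>2)\<close>, which
  vanishes only at the centre (\<open>tension_scaling\<close>).

  For biharmonicity let \<open>V\<close> be a test vector field. Along \<open>a x + s V x\<close> the density of the bienergy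
  is a rational function of \<open>s\<close> whose coefficients are built from \<open>V\<close>, its first partial derivatives
  and its Laplacian. Its derivative at \<open>s = 0\<close> is a constant multiple of the divergence of an
  explicit vector field \<open>flux\<close>, which is supported in the support of \<open>V\<close>
  (\<open>hyp_density_var_scaling\<close>). The integral of such a divergence is zero, since the integral of a
  compactly supported function does not change under translations
  (\<open>integral_directional_derivative_eq_0\<close>). Differentiation under the integral sign
  (\<open>has_real_derivative_integral_compact\<close>) then gives a vanishing first variation
  (\<open>biharmonic_scaling\<close>).

  For stability, conformality reads \<open>\<beta>' = h(\<beta>)\<close>, whence \<open>\<beta>'' = q(\<beta>)\<close>. Put
  \<open>T = \<beta>'' + 2 \<beta>' - 3 q(\<beta>)\<close>, \<open>S = sinh (d \<beta>)\<close> and \<open>C = cosh (d \<beta>)\<close>; then \<open>T = 2 S (1 - C) / d\<close>. The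
  second variation is the integral of \<open>(V'' + 2 V' - 3 q'(\<beta>) V)\<^sup>2 - 3 T q''(\<beta>) V\<^sup>2\<close>, and
  \<open>q''(\<beta>) = 4 d S C\<close> makes the last term equal to \<open>24 S\<^sup>2 C (C - 1) V\<^sup>2\<close>. It is nonnegative,
  and positive wherever \<open>V\<close> and \<open>\<beta>\<close> do not vanish. So both parts of the integrand are
  nonnegative, and the integral is positive (\<open>second_variation_pos\<close>).\<close>

section \<open>Integrals over compact sets\<close>

lemma integrable_on_compact:
  fixes f :: "'a::euclidean_space \<Rightarrow> 'b::euclidean_space"
  assumes "compact K" "continuous_on K f"
  shows "f integrable_on K"
proof -
  have "set_integrable lborel K f"
    unfolding set_integrable_def by (rule borel_integrable_compact[OF assms])
  then show ?thesis by (rule set_borel_integral_eq_integral(1))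
qed

text \<open>The derivative in the parameter is uniformly continuous on a compact product, so by the mean
  value theorem the error of the linear approximation is uniformly small on \<open>K\<close>, and \<open>K\<close> has
  finite measure. Supports of test functions are arbitrary compact sets, not boxes; hence the
  generality in \<open>K\<close>.\<close>

lemma has_real_derivative_integral_compact:
  fixes f :: "real \<Rightarrow> 'a::euclidean_space \<Rightarrow> real"
  assumes K: "compact K"
    and f: "\<And>s. s \<in> {a..b} \<Longrightarrow> continuous_on K (f s)"
    and f': "\<And>s x. s \<in> {a..b} \<Longrightarrow> x \<in> K \<Longrightarrow>
              ((\<lambda>s. f s x) has_real_derivative f' s x) (at s within {a..b})"
    and cf': "continuous_on ({a..b} \<times> K) (\<lambda>(s, x). f' s x)"
    and s0: "s0 \<in> {a..b}"
  shows "((\<lambda>s. integral K (f s)) has_real_derivative integral K (f' s0)) (at s0 within {a..b})"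
proof -
  have uc: "uniformly_continuous_on ({a..b} \<times> K) (\<lambda>(s, x). f' s x)"
    using K cf' by (intro compact_uniformly_continuous compact_Times) auto
  have cf'0: "continuous_on K (f' s0)"
  proof -
    have "continuous_on K (\<lambda>x. (\<lambda>(s, x). f' s x) (s0, x))"
      by (rule continuous_on_compose2[OF cf']) (use s0 in \<open>auto intro!: continuous_intros\<close>)
    then show ?thesis by simp
  qed
  have M: "measure lebesgue K + 1 > 0" using measure_nonneg[of lebesgue K] by linarith
  show ?thesis
    unfolding has_field_derivative_def has_derivative_within_alt
  proof (intro conjI allI impI)
    show "bounded_linear ((*) (integral K (f' s0)))" by (rule bounded_linear_mult_right)
    fix e :: real assume "e > 0"
    \<comment> \<open>The measure of \<open>K\<close> may vanish, hence the summand 1.\<close>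
    define \<eta> where "\<eta> = e / (measure lebesgue K + 1)"
    have \<eta>: "\<eta> > 0" "\<eta> * measure lebesgue K \<le> e"
      using \<open>e > 0\<close> M by (simp_all add: \<eta>_def field_simps)
    obtain \<delta> where \<delta>: "\<delta> > 0"
      "\<And>p p'. p \<in> {a..b} \<times> K \<Longrightarrow> p' \<in> {a..b} \<times> K \<Longrightarrow> dist p' p < \<delta> \<Longrightarrow>
         dist ((\<lambda>(s, x). f' s x) p') ((\<lambda>(s, x). f' s x) p) < \<eta>"
      using uc \<open>\<eta> > 0\<close> unfolding uniformly_continuous_on_def by metis
    show "\<exists>r>0. \<forall>s\<in>{a..b}. norm (s - s0) < r \<longrightarrow>
        norm (integral K (f s) - integral K (f s0) - integral K (f' s0) * (s - s0)) \<le> e * norm (s - s0)"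
    proof (intro exI[of _ \<delta>] conjI ballI impI \<open>\<delta> > 0\<close>)
      fix s assume s: "s \<in> {a..b}" "norm (s - s0) < \<delta>"
      have pt: "norm (f s x - f s0 x - f' s0 x * (s - s0)) \<le> \<eta> * norm (s - s0)" if x: "x \<in> K" for x
      proof -
        define S where "S = {min s s0..max s s0}"
        have S: "S \<subseteq> {a..b}" using s s0 by (auto simp: S_def)
        have "norm ((f s x - f' s0 x * s) - (f s0 x - f' s0 x * s0)) \<le> \<eta> * norm (s - s0)"
        proof (rule field_differentiable_bound[where S=S and f="\<lambda>z. f z x - f' s0 x * z"
                and f'="\<lambda>z. f' z x - f' s0 x"])
          fix z assume z: "z \<in> S"
          have "((\<lambda>z. f z x) has_real_derivative f' z x) (at z within S)"
            by (rule DERIV_subset[OF f' S]) (use z S x in auto)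
          then show "((\<lambda>z. f z x - f' s0 x * z) has_real_derivative f' z x - f' s0 x) (at z within S)"
            by (auto intro!: derivative_eq_intros)
          have "dist (z, x) (s0, x) < \<delta>"
            using z s by (auto simp: S_def dist_Pair_Pair dist_real_def)
          then show "norm (f' z x - f' s0 x) \<le> \<eta>"
            using \<delta>(2)[of "(s0, x)" "(z, x)"] z S s0 x by (auto simp: dist_real_def)
        qed (auto simp: S_def)
        then show ?thesis by (simp add: algebra_simps)
      qed
      have int: "f s integrable_on K" "f s0 integrable_on K" "f' s0 integrable_on K"
        using f[OF s(1)] f[OF s0] cf'0 by (auto intro: integrable_on_compact[OF K])
      have "integral K (f s) - integral K (f s0) - integral K (f' s0) * (s - s0)
          = integral K (\<lambda>x. f s x - f s0 x - f' s0 x * (s - s0))"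
        using int by (simp add: integral_diff integrable_diff integrable_on_mult_left)
      also have "norm \<dots> \<le> integral K (\<lambda>x. \<eta> * norm (s - s0))"
        using int pt K by (intro integral_norm_bound_integral integrable_on_const lmeasurable_compact)
          (auto intro!: integrable_diff integrable_on_mult_left)
      also have "\<dots> = (\<eta> * norm (s - s0)) * measure lebesgue K"
        using K by (simp add: lmeasure_integral lmeasurable_compact flip: integral_mult_right)
      also have "\<dots> \<le> e * norm (s - s0)"
        using mult_right_mono[OF \<eta>(2), of "norm (s - s0)"] by (simp add: ac_simps)
      finally show "norm (integral K (f s) - integral K (f s0) - integral K (f' s0) * (s - s0))
        \<le> e * norm (s - s0)" .
    qed
  qed
qed

lemma integral_superset_of_support:
  fixes f :: "'a::euclidean_space \<Rightarrow> real"
  assumes "K \<subseteq> S" "\<And>x. x \<notin> K \<Longrightarrow> f x = 0"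
  shows "integral S f = integral K f"
proof -
  have "(\<lambda>x. if x \<in> K then f x else 0) = f" using assms(2) by auto
  moreover have "K \<inter> S = K" using assms(1) by auto
  ultimately show ?thesis
    using Henstock_Kurzweil_Integration.integral_restrict_Int[of S K f] by simp
qed

text \<open>The integral of \<open>f (x + h e)\<close> over a large box does not depend on \<open>h\<close> in \<open>[-1, 1]\<close>. Its derivative
  at \<open>h = 0\<close> is the integral of the derivative of \<open>f\<close> in the direction \<open>e\<close>. This replaces the divergence
  theorem: it is applied to each component of a compactly supported field.\<close>

lemma integral_directional_derivative_eq_0:
  fixes f :: "'a::euclidean_space \<Rightarrow> real"
  assumes K: "compact K"
    and supp: "\<And>x. x \<notin> K \<Longrightarrow> f x = 0"
    and f': "\<And>x. ((\<lambda>h. f (x + h *\<^sub>R e)) has_real_derivative f' x) (at 0)"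
    and cf: "continuous_on UNIV f" and cf': "continuous_on UNIV f'"
  shows "integral K f' = 0"
proof -
  have supp': "f' x = 0" if "x \<notin> K" for x
  proof -
    have "((\<lambda>h::real. 0) has_real_derivative f' x) (at 0)"
    proof (rule has_field_derivative_transform_within_open[OF f'[of x]])
      show "open ((\<lambda>h::real. x + h *\<^sub>R e) -` (- K))"
        using K by (intro open_vimage) (auto intro!: continuous_intros compact_imp_closed)
    qed (use that supp in auto)
    then show ?thesis by (metis DERIV_const DERIV_unique)
  qed
  \<comment> \<open>\<open>R\<close> is swept out by the supports of all the translated functions; a box around it contains
  each of these supports.\<close>
  define R where "R = {x + h *\<^sub>R (- e) |x h. x \<in> K \<and> h \<in> {-1..1}}"
  have "compact R"
  proof -
    have "R = (\<lambda>(x, h). x + h *\<^sub>R (- e)) ` (K \<times> {-1..1})"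
      by (force simp: R_def)
    then show ?thesis using K
      by (auto intro!: compact_continuous_image compact_Times continuous_intros simp: case_prod_unfold)
  qed
  then obtain a b where ab: "R \<subseteq> cbox a b"
    using bounded_subset_cbox_symmetric[OF compact_imp_bounded] by metis
  have Kab: "K \<subseteq> cbox a b"
  proof
    fix x assume "x \<in> K"
    then have "x + 0 *\<^sub>R (-e) \<in> R" unfolding R_def by fastforce
    then show "x \<in> cbox a b" using ab by auto
  qed
  have const: "integral (cbox a b) (\<lambda>x. f (x + h *\<^sub>R e)) = integral K f" if h: "h \<in> {-1..1}" for h
  proof -
    have "integral (cbox a b) (\<lambda>x. f (x + h *\<^sub>R e))
        = integral (cbox (a + h *\<^sub>R e) (b + h *\<^sub>R e)) f"
      using integral_shift_cbox_plus[of a b f "h *\<^sub>R e"] by (simp add: o_def add.commute)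
    also have "\<dots> = integral K f"
    proof (rule integral_superset_of_support[OF _ supp])
      show "K \<subseteq> cbox (a + h *\<^sub>R e) (b + h *\<^sub>R e)"
      proof
        fix x assume "x \<in> K"
        then have "x + h *\<^sub>R (- e) \<in> cbox a b" using ab h unfolding R_def by blast
        then show "x \<in> cbox (a + h *\<^sub>R e) (b + h *\<^sub>R e)"
          by (auto simp: mem_box inner_diff_left inner_add_left algebra_simps)
      qed
    qed
    finally show ?thesis .
  qed
  have "((\<lambda>h. integral (cbox a b) (\<lambda>x. f (x + h *\<^sub>R e))) has_real_derivative
          integral (cbox a b) (\<lambda>x. f' (x + 0 *\<^sub>R e))) (at 0 within {-1..1})"
  proof (rule has_real_derivative_integral_compact[where f="\<lambda>h x. f (x + h *\<^sub>R e)"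
        and f'="\<lambda>h x. f' (x + h *\<^sub>R e)"])
    fix s :: real and x :: 'a
    have "((\<lambda>h. f ((x + s *\<^sub>R e) + h *\<^sub>R e)) has_real_derivative f' (x + s *\<^sub>R e)) (at (s - s))"
      using f' by simp
    then have "((\<lambda>h. f (x + h *\<^sub>R e)) has_real_derivative f' (x + s *\<^sub>R e)) (at s)"
      using DERIV_shift[of "\<lambda>h. f (x + h *\<^sub>R e)" _ 0 s]
      by (simp add: scaleR_add_left add_ac)
    then show "((\<lambda>h. f (x + h *\<^sub>R e)) has_real_derivative f' (x + s *\<^sub>R e)) (at s within {-1..1})"
      by (rule has_field_derivative_at_within)
  qed (auto intro!: continuous_on_compose2[OF cf] continuous_on_compose2[OF cf'] continuous_intros
      simp: case_prod_unfold)
  then have D: "((\<lambda>h. integral (cbox a b) (\<lambda>x. f (x + h *\<^sub>R e))) has_real_derivative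
          integral (cbox a b) f') (at 0)"
    using at_within_Icc_at[of "-1" 0 "1::real"] by simp
  have "((\<lambda>h::real. integral K f) has_real_derivative integral (cbox a b) f') (at 0)"
    by (rule has_field_derivative_transform_within_open[OF D, of "{-1<..<1}"]) (auto simp: const)
  then have "integral (cbox a b) f' = 0" by (metis DERIV_const DERIV_unique)
  then show ?thesis using integral_superset_of_support[OF Kab supp'] by simp
qed

lemma integral_compact_pos:
  fixes g :: "'a::euclidean_space \<Rightarrow> real"
  assumes K: "compact K" and g: "continuous_on K g" "\<And>x. x \<in> K \<Longrightarrow> g x \<ge> 0"
    and S: "open S" "S \<subseteq> K" and x: "x \<in> S" "g x \<noteq> 0"
  shows "integral K g > 0"
proof -
  obtain a b where ab: "cbox a b \<subseteq> S" "x \<in> box a b"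
    using open_contains_cbox[of S] S(1) x(1) by metis
  have sub: "cbox a b \<subseteq> K" using ab S by auto
  have int: "g integrable_on K" "g integrable_on cbox a b"
    using g(1) sub K by (auto intro!: integrable_on_compact intro: continuous_on_subset)
  have "integral (cbox a b) g \<noteq> 0"
  proof
    assume "integral (cbox a b) g = 0"
    then have "(g has_integral 0) (cbox a b)" using int(2) by (metis integrable_integral)
    then have "g x = 0"
      using ab sub box_subset_cbox[of a b]
      by (intro has_integral_0_cbox_imp_0[OF continuous_on_subset[OF g(1) sub]]) (auto intro!: g(2))
    with x show False by simp
  qed
  moreover have "integral (cbox a b) g \<ge> 0" using sub g(2) by (intro integral_nonneg int) auto
  moreover have "integral (cbox a b) g \<le> integral K g"
    using int g(2) by (intro integral_subset_le sub) auto
  ultimately show ?thesis by linarith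
qed

section \<open>Smooth functions and test functions\<close>

lemma C_k_cong:
  assumes S: "open S" and eq: "\<And>x. x \<in> S \<Longrightarrow> f x = g x" and f: "C_k k S f"
  shows "C_k k S g"
proof (cases k)
  case 0
  then show ?thesis using f eq by (simp cong: continuous_on_cong)
next
  case (Suc m)
  with f obtain f' where f': "\<forall>x\<in>S. (f has_derivative f' x) (at x)" "\<forall>v. C_k m S (\<lambda>x. f' x v)"
    by auto
  have "\<forall>x\<in>S. (g has_derivative f' x) (at x)"
    using f'(1) S eq by (metis has_derivative_transform_within_open)
  with f'(2) Suc show ?thesis by auto
qed

lemma C_k_const: "C_k k S (\<lambda>x. c)"
proof (induction k arbitrary: c)
  case (Suc k)
  then show ?case by (auto intro!: exI[of _ "\<lambda>x v. 0"])
qed simp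

text \<open>Only the values on \<open>S\<close> matter: both the rotationally symmetric map and the inverse of its
  restriction are scalings on open sets and are unconstrained elsewhere.\<close>

lemma smooth_on_scaling:
  assumes "open S" "\<And>x. x \<in> S \<Longrightarrow> f x = r *\<^sub>R x"
  shows "smooth_on S f"
  unfolding smooth_on_def
proof
  fix k
  have "C_k k S (\<lambda>x. r *\<^sub>R x)"
  proof (cases k)
    case 0
    then show ?thesis by (auto intro!: continuous_intros)
  next
    case (Suc m)
    then show ?thesis using C_k_const
      by (auto intro!: exI[of _ "\<lambda>x v. r *\<^sub>R v"] derivative_eq_intros)
  qed
  then show "C_k k S f" by (rule C_k_cong[OF assms(1), rotated]) (simp add: assms(2))
qed

lemma C_k_Suc_UNIV:
  assumes "C_k (Suc k) UNIV f"
  shows "(f has_derivative frechet_derivative f (at x)) (at x)"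
    and "C_k k UNIV (\<lambda>x. frechet_derivative f (at x) v)"
proof -
  obtain f' where f': "\<And>x. (f has_derivative f' x) (at x)" "\<And>v. C_k k UNIV (\<lambda>x. f' x v)"
    using assms by auto
  have "f' x = frechet_derivative f (at x)" for x using frechet_derivative_at[OF f'(1)] .
  with f' show "(f has_derivative frechet_derivative f (at x)) (at x)"
    "C_k k UNIV (\<lambda>x. frechet_derivative f (at x) v)" by simp_all
qed

lemma frechet_derivative_eq_0_outside_support:
  assumes "compact K" "\<And>x. x \<notin> K \<Longrightarrow> f x = 0" "x \<notin> K"
  shows "frechet_derivative f (at x) = (\<lambda>v. 0)"
proof -
  have "(f has_derivative (\<lambda>v. 0)) (at x)"
    by (rule has_derivative_transform_within_open[of "\<lambda>x. 0" _ _ _ "- K"])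
       (use assms in \<open>auto simp: compact_imp_closed open_Compl\<close>)
  then show ?thesis by (metis frechet_derivative_at)
qed

lemma C_k_Suc_real:
  fixes f :: "real \<Rightarrow> real"
  assumes "C_k (Suc k) UNIV f"
  shows "(f has_real_derivative deriv f x) (at x)" and "C_k k UNIV (deriv f)"
proof -
  obtain f' where f': "\<And>x. (f has_derivative f' x) (at x)" "\<And>v. C_k k UNIV (\<lambda>x. f' x v)"
    using assms by auto
  have D: "(f has_real_derivative f' x 1) (at x)" for x
  proof (rule has_derivative_imp_has_field_derivative[OF f'(1)])
    show "v * f' x 1 = f' x v" for v
      using linear_cmul[OF has_derivative_linear[OF f'(1)], of x v 1] by simp
  qed
  then have "deriv f = (\<lambda>x. f' x 1)" by (auto intro!: DERIV_imp_deriv)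
  with D f'(2)[of 1] show "(f has_real_derivative deriv f x) (at x)" "C_k k UNIV (deriv f)" by auto
qed

text \<open>\<open>W i\<close> and \<open>Z i\<close> are the first and the unmixed second partial derivatives of \<open>V\<close>; the first
  variation involves no others.\<close>

lemma test_function_partials:
  fixes V :: "real ^ 'm::finite \<Rightarrow> 'b::euclidean_space"
  assumes "test_function K V"
  obtains W Z where
    "\<And>x. (V has_derivative frechet_derivative V (at x)) (at x)"
    "\<And>i x. frechet_derivative V (at x) (axis i 1) = W i x"
    "\<And>i x. (W i has_derivative frechet_derivative (W i) (at x)) (at x)"
    "\<And>i x. frechet_derivative (W i) (at x) (axis i 1) = Z i x"
    "continuous_on UNIV V" "\<And>i. continuous_on UNIV (W i)" "\<And>i. continuous_on UNIV (Z i)"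
    "\<And>x. x \<notin> K \<Longrightarrow> V x = 0" "\<And>i x. x \<notin> K \<Longrightarrow> W i x = 0" "\<And>i x. x \<notin> K \<Longrightarrow> Z i x = 0"
proof -
  have K: "compact K" and V: "C_k k UNIV V" and supp: "\<And>x. x \<notin> K \<Longrightarrow> V x = 0" for k
    using assms by (auto simp: test_function_def smooth_on_def)
  define W where "W i x = frechet_derivative V (at x) (axis i 1)" for i x
  define Z where "Z i x = frechet_derivative (W i) (at x) (axis i 1)" for i x
  have W: "C_k k UNIV (W i)" for i k unfolding W_def by (rule C_k_Suc_UNIV(2)[OF V])
  have Z: "C_k k UNIV (Z i)" for i k unfolding Z_def by (rule C_k_Suc_UNIV(2)[OF W])
  have W0: "W i x = 0" if "x \<notin> K" for i x
    unfolding W_def using frechet_derivative_eq_0_outside_support[OF K supp that] by simp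
  have Z0: "Z i x = 0" if "x \<notin> K" for i x
    unfolding Z_def using frechet_derivative_eq_0_outside_support[OF K W0 that] by simp
  show ?thesis
    by (rule that[of W Z])
       (use C_k_Suc_UNIV(1)[OF V] C_k_Suc_UNIV(1)[OF W] V[of 0] W[of 0] Z[of 0] supp W0 Z0
         in \<open>simp_all add: W_def[symmetric] Z_def[symmetric]\<close>)
qed

section \<open>The tension field of a map into hyperbolic space\<close>

lemma partial_eq:
  assumes "(f has_derivative f') (at x)"
  shows "partial i f x = f' (axis i 1)"
  using frechet_derivative_at[OF assms] by (simp add: partial_def)

lemma norm_lt_1_inner: "norm y < 1 \<longleftrightarrow> y \<bullet> y < 1" for y :: "'a::real_inner"
  by (simp add: norm_lt_square)

lemma hyp_metric_eq: "hyp_metric d y = mat (4 / (d\<^sup>2 * (1 - y \<bullet> y)\<^sup>2))"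
  by (simp add: hyp_metric_def dot_square_norm)

lemma metric_inner_hyp:
  "metric_inner (hyp_metric d) y v w = 4 / (d\<^sup>2 * (1 - y \<bullet> y)\<^sup>2) * (v \<bullet> w)"
proof -
  have *: "mat k *v w = k *\<^sub>R w" for k :: real
    by (simp add: vec_eq_iff matrix_vector_mult_def mat_def if_distrib[where f="\<lambda>x. x * _"] cong: if_cong)
  show ?thesis by (simp add: metric_inner_def hyp_metric_eq *)
qed

lemma matrix_inv_mat:
  assumes "(k::real) \<noteq> 0"
  shows "matrix_inv (mat k :: real ^ 'n ^ 'n::finite) = mat (1 / k)"
proof -
  have mm: "mat a ** mat b = (mat (a * b) :: real ^ 'n ^ 'n)" for a b
    by (auto simp: vec_eq_iff matrix_matrix_mult_def mat_def if_distrib[where f="\<lambda>x. x * _"] cong: if_cong)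
  have "mat k ** matrix_inv (mat k) = (mat 1 :: real ^ 'n ^ 'n)"
    unfolding matrix_inv_def
    by (rule someI2[of _ "mat (1 / k)"]) (use assms mm in auto)
  then have "mat (1 / k) ** (mat k ** matrix_inv (mat k)) = (mat (1 / k) :: real ^ 'n ^ 'n)" by simp
  then show ?thesis using assms mm[of "1 / k" k] by (simp add: matrix_mul_assoc)
qed

text \<open>For a conformal metric \<open>\<lambda>\<^sup>2 \<delta>\<^sub>i\<^sub>j\<close> the Christoffel symbols are
  \<open>\<delta>\<^sub>k\<^sub>i F\<^sub>j + \<delta>\<^sub>k\<^sub>j F\<^sub>i - \<delta>\<^sub>i\<^sub>j F\<^sub>k\<close> with \<open>F = grad (ln \<lambda>)\<close>. Here \<open>\<lambda> = 2 / (d (1 - |y|\<^sup>2))\<close> and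
  \<open>F = 2 y / (1 - |y|\<^sup>2)\<close>; the curvature scale \<open>d\<close> drops out.\<close>

lemma christoffel_hyp:
  assumes d: "d \<noteq> 0" and y: "norm y < 1"
  shows "christoffel (hyp_metric d) y k i j = 2 / (1 - y \<bullet> y) *
     ((if k = i then y $ j else 0) + (if k = j then y $ i else 0) - (if i = j then y $ k else 0))"
proof -
  define u where "u = 1 - y \<bullet> y"
  have u: "u > 0" using y by (simp add: u_def norm_lt_1_inner)
  have D: "((\<lambda>z. 4 / (d\<^sup>2 * (1 - z \<bullet> z)\<^sup>2)) has_derivative (\<lambda>h. 16 * (y \<bullet> h) / (d\<^sup>2 * u ^ 3))) (at y)"
  proof -
    have "((\<lambda>v. 4 / (d\<^sup>2 * v\<^sup>2)) has_real_derivative - 8 / (d\<^sup>2 * u ^ 3)) (at u)"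
      using u d by (auto intro!: derivative_eq_intros simp: field_simps power2_eq_square power3_eq_cube)
    moreover have "((\<lambda>z. 1 - z \<bullet> z) has_derivative (\<lambda>h. - 2 * (y \<bullet> h))) (at y)"
      by (auto intro!: derivative_eq_intros simp: inner_commute)
    ultimately have "((\<lambda>z. 4 / (d\<^sup>2 * (1 - z \<bullet> z)\<^sup>2)) has_derivative
        (\<lambda>h. - 2 * (y \<bullet> h) * (- 8 / (d\<^sup>2 * u ^ 3)))) (at y)"
      unfolding u_def by (rule DERIV_compose_FDERIV)
    then show ?thesis by (rule has_derivative_eq_rhs) (simp add: fun_eq_iff)
  qed
  have p: "partial i (\<lambda>z. hyp_metric d z $ j $ l) y
      = (if j = l then 16 * y $ i / (d\<^sup>2 * u ^ 3) else 0)" for i j l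
  proof (cases "j = l")
    case True
    then have "(\<lambda>z. hyp_metric d z $ j $ l) = (\<lambda>z. 4 / (d\<^sup>2 * (1 - z \<bullet> z)\<^sup>2))"
      by (simp add: hyp_metric_eq mat_def)
    then show ?thesis using partial_eq[OF D, of i] True by (simp add: inner_axis)
  next
    case False
    then have "(\<lambda>z. hyp_metric d z $ j $ l) = (\<lambda>z. 0)" by (simp add: hyp_metric_eq mat_def)
    then show ?thesis using partial_eq[of "\<lambda>z. 0" "\<lambda>h. 0" y i] False by simp
  qed
  have "matrix_inv (hyp_metric d y) = mat (d\<^sup>2 * u\<^sup>2 / 4)"
    using u d matrix_inv_mat[of "4 / (d\<^sup>2 * u\<^sup>2)"] by (simp add: hyp_metric_eq u_def)
  then have inv: "matrix_inv (hyp_metric d y) $ k $ l = (if k = l then d\<^sup>2 * u\<^sup>2 / 4 else 0)" for l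
    by (simp add: mat_def)
  have "christoffel (hyp_metric d) y k i j = 1/2 * (d\<^sup>2 * u\<^sup>2 / 4 *
     ((if j = k then 16 * y $ i / (d\<^sup>2 * u ^ 3) else 0) + (if i = k then 16 * y $ j / (d\<^sup>2 * u ^ 3) else 0)
     - (if i = j then 16 * y $ k / (d\<^sup>2 * u ^ 3) else 0)))"
    unfolding christoffel_def inv p by (simp add: if_distrib[where f="\<lambda>x. x * _"] cong: if_cong)
  also have "\<dots> = 2 / u *
     ((if k = i then y $ j else 0) + (if k = j then y $ i else 0) - (if i = j then y $ k else 0))"
    using u d by (simp add: field_simps power2_eq_square power3_eq_cube)
  finally show ?thesis by (simp add: u_def)
qed

text \<open>The tension field at a point depends on the value \<open>y\<close> of the map, its partial derivatives \<open>A i\<close>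
  and its Laplacian \<open>L\<close>. The following two definitions express it in these terms; \<open>hyp_quad\<close> is
  the part quadratic in \<open>A\<close>, without the factor \<open>2 / (1 - |y|\<^sup>2)\<close>. Separating the values from the map
  makes the variation below a calculus of curves in finite-dimensional spaces.\<close>

definition hyp_quad :: "real ^ 4 \<Rightarrow> ('m::finite \<Rightarrow> real ^ 4) \<Rightarrow> real ^ 4" where
  "hyp_quad y A = (\<Sum>i\<in>UNIV. (2 * (A i \<bullet> y)) *\<^sub>R A i - (A i \<bullet> A i) *\<^sub>R y)"

definition hyp_tension :: "real ^ 4 \<Rightarrow> ('m::finite \<Rightarrow> real ^ 4) \<Rightarrow> real ^ 4 \<Rightarrow> real ^ 4" where
  "hyp_tension y A L = L + (2 / (1 - y \<bullet> y)) *\<^sub>R hyp_quad y A"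

text \<open>The second order part gives \<open>L\<close>; contracting the Christoffel symbols with \<open>a a\<close> gives
  \<open>2 (a \<bullet> F) a - (a \<bullet> a) F\<close> with \<open>F = 2 y / (1 - |y|\<^sup>2)\<close>, and \<open>a\<close> runs
  through the partial derivatives of the map.\<close>

lemma tension_hyp:
  fixes \<psi> :: "real ^ 'm::finite \<Rightarrow> real ^ 4"
  assumes d: "d \<noteq> 0" and \<Omega>: "open \<Omega>" "x \<in> \<Omega>" and y: "norm (\<psi> x) < 1"
    and A: "\<And>z i. z \<in> \<Omega> \<Longrightarrow> \<exists>D. (\<psi> has_derivative D) (at z) \<and> D (axis i 1) = A i z"
    and L: "\<And>i. \<exists>D. (A i has_derivative D) (at x) \<and> D (axis i 1) = L i"
  shows "tension (hyp_metric d) \<psi> x = hyp_tension (\<psi> x) (\<lambda>i. A i x) (\<Sum>i\<in>UNIV. L i)"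
proof -
  have p1: "partial i (\<lambda>z. \<psi> z $ k) z = A i z $ k" if z: "z \<in> \<Omega>" for i k z
  proof -
    obtain D where D: "(\<psi> has_derivative D) (at z)" "D (axis i 1) = A i z" using A[OF z] by blast
    have "((\<lambda>z. \<psi> z $ k) has_derivative (\<lambda>h. D h $ k)) (at z)"
      by (rule bounded_linear.has_derivative[OF bounded_linear_vec_nth D(1)])
    from partial_eq[OF this] D(2) show ?thesis by simp
  qed
  have p2: "partial i (partial i (\<lambda>z. \<psi> z $ k)) x = L i $ k" for i k
  proof -
    obtain D where D: "(A i has_derivative D) (at x)" "D (axis i 1) = L i" using L by blast
    have "((\<lambda>z. A i z $ k) has_derivative (\<lambda>h. D h $ k)) (at x)"
      by (rule bounded_linear.has_derivative[OF bounded_linear_vec_nth D(1)])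
    then have "(partial i (\<lambda>z. \<psi> z $ k) has_derivative (\<lambda>h. D h $ k)) (at x)"
      by (rule has_derivative_transform_within_open[OF _ \<Omega>]) (simp add: p1)
    from partial_eq[OF this] D(2) show ?thesis by simp
  qed
  define y where "y = \<psi> x"
  have quad: "(\<Sum>j\<in>UNIV. \<Sum>l\<in>UNIV. christoffel (hyp_metric d) y k j l * a $ j * a $ l)
      = 2 / (1 - y \<bullet> y) * (2 * (a \<bullet> y) * a $ k - (a \<bullet> a) * y $ k)" for a k
  proof -
    have "(\<Sum>j\<in>UNIV. \<Sum>l\<in>UNIV. christoffel (hyp_metric d) y k j l * a $ j * a $ l)
      = 2 / (1 - y \<bullet> y) * (\<Sum>j\<in>UNIV. \<Sum>l\<in>UNIV. (if k = j then y $ l * a $ j * a $ l else 0)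
         + (if k = l then y $ j * a $ j * a $ l else 0) - (if j = l then y $ k * a $ j * a $ l else 0))"
      unfolding sum_distrib_left
      by (intro sum.cong refl) (use d \<open>norm (\<psi> x) < 1\<close> in \<open>auto simp: christoffel_hyp y_def algebra_simps\<close>)
    also have "(\<Sum>j\<in>UNIV. \<Sum>l\<in>UNIV. (if k = j then y $ l * a $ j * a $ l else 0)
         + (if k = l then y $ j * a $ j * a $ l else 0) - (if j = l then y $ k * a $ j * a $ l else 0))
      = (\<Sum>l\<in>UNIV. \<Sum>j\<in>UNIV. if k = j then y $ l * a $ j * a $ l else 0)
        + (\<Sum>j\<in>UNIV. \<Sum>l\<in>UNIV. if k = l then y $ j * a $ j * a $ l else 0)
        - (\<Sum>j\<in>UNIV. \<Sum>l\<in>UNIV. if j = l then y $ k * a $ j * a $ l else 0)"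
      by (subst (2) sum.swap) (simp add: sum.distrib sum_subtractf)
    also have "\<dots> = 2 * (a \<bullet> y) * a $ k - (a \<bullet> a) * y $ k"
      by (simp add: inner_vec_def sum_distrib_left sum_distrib_right algebra_simps
          flip: sum.distrib sum_subtractf)
    finally show ?thesis .
  qed
  show ?thesis
    by (simp add: vec_eq_iff hyp_tension_def hyp_quad_def tension_def p1[OF \<Omega>(2)] p2 quad[unfolded y_def] sum.distrib
        sum_distrib_left scaleR_sum_right)
qed

section \<open>First variation of the energy density\<close>

text \<open>The functions with suffix \<open>var\<close> are the derivatives along curves \<open>(y, A, L)\<close> with velocity
  \<open>(v, w, l)\<close>.\<close>

definition hyp_quad_var ::
    "real ^ 4 \<Rightarrow> ('m::finite \<Rightarrow> real ^ 4) \<Rightarrow> real ^ 4 \<Rightarrow> ('m \<Rightarrow> real ^ 4) \<Rightarrow> real ^ 4" where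
  "hyp_quad_var y A v w = (\<Sum>i\<in>UNIV. (2 * (w i \<bullet> y + A i \<bullet> v)) *\<^sub>R A i + (2 * (A i \<bullet> y)) *\<^sub>R w i
      - (2 * (A i \<bullet> w i)) *\<^sub>R y - (A i \<bullet> A i) *\<^sub>R v)"

definition hyp_tension_var :: "real ^ 4 \<Rightarrow> ('m::finite \<Rightarrow> real ^ 4) \<Rightarrow> real ^ 4 \<Rightarrow> ('m \<Rightarrow> real ^ 4)
    \<Rightarrow> real ^ 4 \<Rightarrow> real ^ 4" where
  "hyp_tension_var y A v w l = l + (4 * (y \<bullet> v) / (1 - y \<bullet> y)\<^sup>2) *\<^sub>R hyp_quad y A
     + (2 / (1 - y \<bullet> y)) *\<^sub>R hyp_quad_var y A v w"

definition hyp_density :: "real \<Rightarrow> real ^ 4 \<Rightarrow> ('m::finite \<Rightarrow> real ^ 4) \<Rightarrow> real ^ 4 \<Rightarrow> real" where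
  "hyp_density d y A L
     = 4 / (d\<^sup>2 * (1 - y \<bullet> y)\<^sup>2) * (hyp_tension y A L \<bullet> hyp_tension y A L)"

definition hyp_density_var :: "real \<Rightarrow> real ^ 4 \<Rightarrow> ('m::finite \<Rightarrow> real ^ 4) \<Rightarrow> real ^ 4 \<Rightarrow> real ^ 4
    \<Rightarrow> ('m \<Rightarrow> real ^ 4) \<Rightarrow> real ^ 4 \<Rightarrow> real" where
  "hyp_density_var d y A L v w l
     = 16 * (y \<bullet> v) / (d\<^sup>2 * (1 - y \<bullet> y) ^ 3) * (hyp_tension y A L \<bullet> hyp_tension y A L)
       + 8 / (d\<^sup>2 * (1 - y \<bullet> y)\<^sup>2) * (hyp_tension y A L \<bullet> hyp_tension_var y A v w l)"

lemma has_real_derivative_inner: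
  fixes f g :: "real \<Rightarrow> 'a::real_inner"
  assumes "(f has_vector_derivative f') (at t)" "(g has_vector_derivative g') (at t)"
  shows "((\<lambda>t. f t \<bullet> g t) has_real_derivative (f t \<bullet> g' + f' \<bullet> g t)) (at t)"
  using bounded_bilinear.has_vector_derivative[OF bounded_bilinear_inner assms]
  by (simp add: has_real_derivative_iff_has_vector_derivative)

lemma hyp_density_has_derivative:
  assumes d: "d \<noteq> 0" and 1: "y s \<bullet> y s < 1"
    and y: "(y has_vector_derivative v) (at s)"
    and A: "\<And>i. ((\<lambda>s. A s i) has_vector_derivative w i) (at s)"
    and L: "(L has_vector_derivative l) (at s)"
  shows "((\<lambda>s. hyp_density d (y s) (A s) (L s)) has_real_derivative
           hyp_density_var d (y s) (A s) (L s) v w l) (at s)"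
proof -
  define u where "u = 1 - y s \<bullet> y s"
  have u: "u > 0" using 1 by (simp add: u_def)
  have U: "((\<lambda>s. 1 - y s \<bullet> y s) has_real_derivative - 2 * (y s \<bullet> v)) (at s)"
    by (rule DERIV_cong[OF DERIV_diff[OF DERIV_const has_real_derivative_inner[OF y y]]])
       (simp add: inner_commute)
  have I: "((\<lambda>s. 2 / (1 - y s \<bullet> y s)) has_real_derivative 4 * (y s \<bullet> v) / u\<^sup>2) (at s)"
    by (rule DERIV_cong[OF DERIV_divide[OF DERIV_const U]])
       (use u in \<open>simp_all add: u_def[symmetric] power2_eq_square\<close>)
  have J: "((\<lambda>s. 4 / (d\<^sup>2 * (1 - y s \<bullet> y s)\<^sup>2)) has_real_derivative 16 * (y s \<bullet> v) / (d\<^sup>2 * u ^ 3)) (at s)"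
    by (rule DERIV_cong[OF DERIV_divide[OF DERIV_const DERIV_cmult[OF DERIV_power[OF U]]]])
       (use u d in \<open>simp_all add: u_def[symmetric] power2_eq_square power3_eq_cube\<close>)
  have Q: "((\<lambda>s. hyp_quad (y s) (A s)) has_vector_derivative hyp_quad_var (y s) (A s) v w) (at s)"
    unfolding hyp_quad_def hyp_quad_var_def
  proof (rule has_vector_derivative_sum)
    fix i
    note Ay = DERIV_cmult[OF has_real_derivative_inner[OF A[of i] y], of 2]
    note AA = has_real_derivative_inner[OF A[of i] A[of i]]
    show "((\<lambda>s. (2 * (A s i \<bullet> y s)) *\<^sub>R A s i - (A s i \<bullet> A s i) *\<^sub>R y s) has_vector_derivative
       (2 * (w i \<bullet> y s + A s i \<bullet> v)) *\<^sub>R A s i + (2 * (A s i \<bullet> y s)) *\<^sub>R w i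
      - (2 * (A s i \<bullet> w i)) *\<^sub>R y s - (A s i \<bullet> A s i) *\<^sub>R v) (at s)"
      by (rule has_vector_derivative_eq_rhs[OF has_vector_derivative_diff[OF
              has_vector_derivative_scaleR[OF Ay A] has_vector_derivative_scaleR[OF AA y]]])
         (simp add: algebra_simps inner_commute flip: scaleR_add_left)
  qed
  have T: "((\<lambda>s. hyp_tension (y s) (A s) (L s)) has_vector_derivative
       hyp_tension_var (y s) (A s) v w l) (at s)"
    unfolding hyp_tension_def hyp_tension_var_def
    by (rule has_vector_derivative_eq_rhs[OF has_vector_derivative_add[OF
            L has_vector_derivative_scaleR[OF I Q]]])
       (simp add: u_def)
  show ?thesis
    unfolding hyp_density_def hyp_density_var_def
    by (rule DERIV_cong[OF DERIV_mult[OF J has_real_derivative_inner[OF T T]]])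
       (simp add: u_def inner_commute field_simps)
qed

section \<open>Scalings of Euclidean space as maps into hyperbolic space\<close>

lemma hyp_quad_scaling:
  "hyp_quad (a *\<^sub>R x) (\<lambda>i. a *\<^sub>R axis i 1 :: real ^ 4) = (- 2 * a ^ 3) *\<^sub>R x"
proof -
  have xx: "(\<Sum>i\<in>UNIV. x $ i *\<^sub>R axis i 1) = x"
    by (simp add: vec_eq_iff axis_def if_distrib[where f="\<lambda>r. _ * r"] cong: if_cong)
  have "hyp_quad (a *\<^sub>R x) (\<lambda>i. a *\<^sub>R axis i 1 :: real ^ 4)
      = (\<Sum>i\<in>UNIV. (2 * a ^ 3) *\<^sub>R (x $ i *\<^sub>R axis i 1) - (a ^ 3) *\<^sub>R x)"
    unfolding hyp_quad_def
    by (intro sum.cong refl) (simp add: inner_axis' inner_axis power3_eq_cube mult_ac)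
  also have "\<dots> = (2 * a ^ 3) *\<^sub>R x - (4 * a ^ 3) *\<^sub>R x"
    unfolding sum_subtractf scaleR_sum_right[symmetric] xx by (simp add: scaleR_conv_of_real)
  finally show ?thesis by (simp flip: scaleR_diff_left)
qed

lemma hyp_tension_scaling:
  "hyp_tension (a *\<^sub>R x) (\<lambda>i. a *\<^sub>R axis i 1 :: real ^ 4) 0 = (- 4 * a ^ 3 / (1 - a\<^sup>2 * (x \<bullet> x))) *\<^sub>R x"
  by (simp add: hyp_tension_def hyp_quad_scaling power2_eq_square mult.assoc)

lemma tension_scaling:
  assumes d: "d \<noteq> 0" and \<Omega>: "open \<Omega>" "x \<in> \<Omega>" and \<phi>: "\<And>x. x \<in> \<Omega> \<Longrightarrow> \<phi> x = a *\<^sub>R x"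
    and 1: "norm (a *\<^sub>R x) < 1"
  shows "tension (hyp_metric d) \<phi> x = (- 4 * a ^ 3 / (1 - a\<^sup>2 * (x \<bullet> x))) *\<^sub>R (x :: real ^ 4)"
proof -
  have "tension (hyp_metric d) \<phi> x = hyp_tension (\<phi> x) (\<lambda>i. a *\<^sub>R axis i 1) (\<Sum>i::4\<in>UNIV. 0)"
  proof (rule tension_hyp[where A="\<lambda>i x. a *\<^sub>R axis i 1", OF d \<Omega>])
    fix z i assume z: "z \<in> \<Omega>"
    have "((*\<^sub>R) a has_derivative (*\<^sub>R) a) (at z)" by (auto intro!: derivative_eq_intros)
    then have "(\<phi> has_derivative (*\<^sub>R) a) (at z)"
      by (rule has_derivative_transform_within_open[OF _ \<Omega>(1) z]) (simp add: \<phi>)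
    then show "\<exists>D. (\<phi> has_derivative D) (at z) \<and> D (axis i 1) = a *\<^sub>R axis i 1" by blast
  next
    fix i
    show "\<exists>D. ((\<lambda>x. a *\<^sub>R axis i 1 :: real ^ 4) has_derivative D) (at x) \<and> D (axis i 1) = 0"
      by (intro exI[of _ "\<lambda>h. 0"]) simp
  qed (use 1 \<Omega> \<phi> in simp)
  then show ?thesis by (simp only: \<phi>[OF \<Omega>(2)] sum.neutral_const hyp_tension_scaling)
qed

lemma conformal_diffeomorphism_scaling:
  assumes d: "d > 0" and a: "a > 0" and \<phi>: "\<And>x. x \<in> ball 0 (1 / a) \<Longrightarrow> \<phi> x = a *\<^sub>R x"
  shows "conformal_diffeomorphism (hyp_metric d) (ball 0 (1 / a)) hyp_space \<phi>"
  unfolding conformal_diffeomorphism_def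
proof (intro conjI exI ballI allI)
  let ?B = "ball (0 :: real ^ 4) (1 / a)"
  have lt1: "norm (a *\<^sub>R x) < 1" if "x \<in> ?B" for x
    using that a by (simp add: field_simps)
  show bij: "bij_betw \<phi> ?B hyp_space"
    by (rule bij_betw_byWitness[where f'="\<lambda>y. (1 / a) *\<^sub>R y"])
       (use a \<phi> lt1 in \<open>auto simp: hyp_space_def field_simps\<close>)
  show "smooth_on ?B \<phi>" by (rule smooth_on_scaling[OF open_ball \<phi>])
  show "smooth_on hyp_space (inv_into ?B \<phi>)"
  proof (rule smooth_on_scaling)
    show "open hyp_space" by (simp add: hyp_space_def)
    fix y assume "y \<in> hyp_space"
    then have "(1 / a) *\<^sub>R y \<in> ?B" using a by (simp add: hyp_space_def field_simps)
    with a bij show "inv_into ?B \<phi> y = (1 / a) *\<^sub>R y"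
      by (intro inv_into_f_eq) (auto simp: bij_betw_def \<phi>)
  qed
  fix x v w assume x: "x \<in> ?B"
  have pos: "1 - (a *\<^sub>R x) \<bullet> (a *\<^sub>R x) > 0" using lt1[OF x] unfolding norm_lt_1_inner by linarith
  then show "2 * a / (d * (1 - (a *\<^sub>R x) \<bullet> (a *\<^sub>R x))) > 0" using a d by simp
  have "((*\<^sub>R) a has_derivative (*\<^sub>R) a) (at x)" by (auto intro!: derivative_eq_intros)
  then have "(\<phi> has_derivative (*\<^sub>R) a) (at x)"
    by (rule has_derivative_transform_within_open[OF _ open_ball x]) (simp add: \<phi>)
  then have "frechet_derivative \<phi> (at x) = (*\<^sub>R) a" by (metis frechet_derivative_at)
  then show "metric_inner (hyp_metric d) (\<phi> x) (frechet_derivative \<phi> (at x) v)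
      (frechet_derivative \<phi> (at x) w) = (2 * a / (d * (1 - (a *\<^sub>R x) \<bullet> (a *\<^sub>R x))))\<^sup>2 * (v \<bullet> w)"
    unfolding metric_inner_hyp \<phi>[OF x] by (simp add: power2_eq_square mult_ac)
qed

section \<open>Biharmonicity of scalings\<close>

text \<open>Put \<open>U = 1 - a\<^sup>2 |x|\<^sup>2\<close>. Up to the factor \<open>32 a\<^sup>3 / d\<^sup>2\<close>, the derivative of the density along a variation \<open>V\<close>
  of the scaling by \<open>a\<close> is
  \<open>- U\<^sup>-\<^sup>3 x \<bullet> \<Delta>V - 8 a\<^sup>2 U\<^sup>-\<^sup>4 (\<Sum>\<^sub>i x\<^sub>i (x \<bullet> \<partial>\<^sub>i V)) + 4 a\<^sup>2 U\<^sup>-\<^sup>4 |x|\<^sup>2 div V + (4 a\<^sup>2 U\<^sup>-\<^sup>4 + 16 a\<^sup>4 U\<^sup>-\<^sup>5 |x|\<^sup>2) x \<bullet> V\<close>.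
  Integration by parts moves all derivatives away from \<open>V\<close>. In dimension four the remaining
  terms of order zero cancel, so the expression is a divergence: of the field whose component \<open>i\<close>
  is \<open>flux\<close> with \<open>v = V x\<close> and \<open>w = \<partial>\<^sub>i V x\<close>.\<close>

definition flux :: "real \<Rightarrow> 4 \<Rightarrow> real ^ 4 \<Rightarrow> real ^ 4 \<Rightarrow> real ^ 4 \<Rightarrow> real" where
  "flux a i x v w = (let U = 1 - a\<^sup>2 * (x \<bullet> x) in
     1 / U ^ 3 * (v $ i - x \<bullet> w)
     + 1 / U ^ 4 * (a\<^sup>2 * (4 * ((x \<bullet> x) * v $ i) - 2 * (x $ i * (x \<bullet> v)))))"

text \<open>The partial derivative of that component, with \<open>z = \<partial>\<^sub>i \<partial>\<^sub>i V x\<close>: the product rule for the four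
  summands \<open>- (x \<bullet> w) / U\<^sup>3\<close>, \<open>v\<^sub>i / U\<^sup>3\<close>, \<open>- 2 a\<^sup>2 x\<^sub>i (x \<bullet> v) / U\<^sup>4\<close> and \<open>4 a\<^sup>2 |x|\<^sup>2 v\<^sub>i / U\<^sup>4\<close> of \<open>flux\<close>, where
  \<open>\<partial>\<^sub>i U = - 2 a\<^sup>2 x\<^sub>i\<close>.\<close>

definition flux_deriv :: "real \<Rightarrow> 4 \<Rightarrow> real ^ 4 \<Rightarrow> real ^ 4 \<Rightarrow> real ^ 4 \<Rightarrow> real ^ 4 \<Rightarrow> real" where
  "flux_deriv a i x v w z = (let U = 1 - a\<^sup>2 * (x \<bullet> x) in
       - (6 * a\<^sup>2 * x $ i * (x \<bullet> w) / U ^ 4 + (w $ i + x \<bullet> z) / U ^ 3)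
       + (6 * a\<^sup>2 * x $ i * v $ i / U ^ 4 + w $ i / U ^ 3)
       - 2 * a\<^sup>2 * (8 * a\<^sup>2 * (x $ i)\<^sup>2 * (x \<bullet> v) / U ^ 5 + ((x \<bullet> v) + x $ i * (v $ i + x \<bullet> w)) / U ^ 4)
       + 4 * a\<^sup>2 * (8 * a\<^sup>2 * x $ i * (x \<bullet> x) * v $ i / U ^ 5
            + (2 * x $ i * v $ i + (x \<bullet> x) * w $ i) / U ^ 4))"

text \<open>Both sides are evaluated in terms of the five sums \<open>N\<close>, \<open>p\<close>, \<open>P\<close>, \<open>Q\<close>, \<open>l\<close> introduced in the
  proof. The number four of coordinates enters through the summands that do not depend on the
  index, and through \<open>hyp_quad_scaling\<close>.\<close>

lemma hyp_density_var_scaling: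
  fixes x v :: "real ^ 4" and w z :: "4 \<Rightarrow> real ^ 4"
  assumes "1 - a\<^sup>2 * (x \<bullet> x) \<noteq> 0" and d: "d \<noteq> 0"
  shows "hyp_density_var d (a *\<^sub>R x) (\<lambda>i. a *\<^sub>R axis i 1) 0 v w (\<Sum>i\<in>UNIV. z i)
    = 32 * a ^ 3 / d\<^sup>2 * (\<Sum>i\<in>UNIV. flux_deriv a i x v (w i) (z i))"
proof -
  define U where "U = 1 - a\<^sup>2 * (x \<bullet> x)"
  have U: "U \<noteq> 0" using assms(1) by (simp add: U_def)
  define N where "N = x \<bullet> x"
  define p where "p = x \<bullet> v"
  define P where "P = (\<Sum>i\<in>UNIV. x $ i * (x \<bullet> w i))"
  define Q where "Q = (\<Sum>i\<in>UNIV. w i $ i)"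
  define l where "l = (\<Sum>i\<in>UNIV. x \<bullet> z i)"
  have sN: "(\<Sum>i\<in>UNIV. (x $ i)\<^sup>2) = N" by (simp add: N_def inner_vec_def power2_eq_square)
  have sp: "(\<Sum>i\<in>UNIV. x $ i * v $ i) = p" by (simp add: p_def inner_vec_def)
  have Uy: "1 - (a *\<^sub>R x) \<bullet> (a *\<^sub>R x) = U" by (simp add: U_def power2_eq_square)
  have q1: "x \<bullet> hyp_quad_var (a *\<^sub>R x) (\<lambda>i. a *\<^sub>R axis i 1) v w = a\<^sup>2 * (4 * P - 2 * N * Q - 2 * p)"
  proof -
    have "x \<bullet> hyp_quad_var (a *\<^sub>R x) (\<lambda>i. a *\<^sub>R axis i 1) v w
      = (\<Sum>i\<in>UNIV. a\<^sup>2 * (4 * (x $ i * (x \<bullet> w i)) + 2 * (x $ i * v $ i) - 2 * N * w i $ i - p))"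
      unfolding hyp_quad_var_def inner_sum_right
      by (intro sum.cong refl)
         (simp add: inner_axis inner_axis' inner_add_right inner_diff_right N_def p_def
           power2_eq_square inner_commute algebra_simps)
    also have "\<dots> = a\<^sup>2 * (4 * P + 2 * p - 2 * N * Q - 4 * p)"
      unfolding sum_distrib_left[symmetric] sum.distrib sum_subtractf P_def Q_def sp by simp
    finally show ?thesis by simp
  qed
  have "(\<Sum>i\<in>UNIV. flux_deriv a i x v (w i) (z i)) = (\<Sum>i\<in>UNIV. - 8 * a\<^sup>2 / U ^ 4 * (x $ i * (x \<bullet> w i)) - (x \<bullet> z i) / U ^ 3
       + (12 * a\<^sup>2 / U ^ 4 + 32 * a ^ 4 * N / U ^ 5) * (x $ i * v $ i)
       - 16 * a ^ 4 * p / U ^ 5 * (x $ i)\<^sup>2 - 2 * a\<^sup>2 * p / U ^ 4 + 4 * a\<^sup>2 * N / U ^ 4 * w i $ i)"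
    unfolding flux_deriv_def Let_def U_def[symmetric] unfolding N_def[symmetric] p_def[symmetric]
    by (intro sum.cong refl) (use U in \<open>simp add: divide_simps, simp add: algebra_simps eval_nat_numeral\<close>)
  also have "\<dots> = - 8 * a\<^sup>2 / U ^ 4 * P - l / U ^ 3 + (12 * a\<^sup>2 / U ^ 4 + 32 * a ^ 4 * N / U ^ 5) * p
       - 16 * a ^ 4 * p / U ^ 5 * N - 8 * a\<^sup>2 * p / U ^ 4 + 4 * a\<^sup>2 * N / U ^ 4 * Q"
    unfolding sum.distrib sum_subtractf sum_distrib_left[symmetric] sum_divide_distrib[symmetric] sN sp
      P_def Q_def l_def by simp
  finally have D: "(\<Sum>i\<in>UNIV. flux_deriv a i x v (w i) (z i)) = - 8 * a\<^sup>2 / U ^ 4 * P - l / U ^ 3 + (12 * a\<^sup>2 / U ^ 4 + 32 * a ^ 4 * N / U ^ 5) * p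
       - 16 * a ^ 4 * p / U ^ 5 * N - 8 * a\<^sup>2 * p / U ^ 4 + 4 * a\<^sup>2 * N / U ^ 4 * Q" .
  have t0: "hyp_tension (a *\<^sub>R x) (\<lambda>i. a *\<^sub>R axis i 1 :: real ^ 4) 0 = (- 4 * a ^ 3 / U) *\<^sub>R x"
    by (simp add: hyp_tension_scaling U_def)
  have t1: "x \<bullet> hyp_tension_var (a *\<^sub>R x) (\<lambda>i. a *\<^sub>R axis i 1) v w (\<Sum>i\<in>UNIV. z i)
     = l + 4 * a * p / U\<^sup>2 * (- 2 * a ^ 3 * N) + 2 / U * (a\<^sup>2 * (4 * P - 2 * N * Q - 2 * p))"
    unfolding hyp_tension_var_def Uy hyp_quad_scaling inner_add_right inner_scaleR_right q1
    by (simp add: l_def inner_sum_right N_def p_def Uy[simplified])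
  have "hyp_density_var d (a *\<^sub>R x) (\<lambda>i. a *\<^sub>R axis i 1) 0 v w (\<Sum>i\<in>UNIV. z i)
    = 16 * (a * p) / (d\<^sup>2 * U ^ 3) * ((- 4 * a ^ 3 / U) * ((- 4 * a ^ 3 / U) * N))
      + 8 / (d\<^sup>2 * U\<^sup>2) * ((- 4 * a ^ 3 / U) * (l + 4 * a * p / U\<^sup>2 * (- 2 * a ^ 3 * N)
          + 2 / U * (a\<^sup>2 * (4 * P - 2 * N * Q - 2 * p))))"
    unfolding hyp_density_var_def Uy t0 unfolding inner_scaleR_left inner_scaleR_right t1
    by (simp only: N_def p_def)
  also have "\<dots> = 32 * a ^ 3 / d\<^sup>2 * (\<Sum>i\<in>UNIV. flux_deriv a i x v (w i) (z i))"
    unfolding D using U d by (simp add: divide_simps) (simp add: algebra_simps eval_nat_numeral)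
  finally show ?thesis .
qed

lemma has_vector_derivative_along:
  assumes "(f has_derivative f') (at x)"
  shows "((\<lambda>h. f (x + h *\<^sub>R e)) has_vector_derivative f' e) (at 0)"
proof -
  interpret f': bounded_linear f' using assms by (rule has_derivative_bounded_linear)
  have "((\<lambda>h. x + h *\<^sub>R e) has_derivative (\<lambda>h. h *\<^sub>R e)) (at 0)"
    by (auto intro!: derivative_eq_intros)
  moreover have "(f has_derivative f') (at (x + 0 *\<^sub>R e))" using assms by simp
  ultimately have "((\<lambda>h. f (x + h *\<^sub>R e)) has_derivative (\<lambda>h. f' (h *\<^sub>R e))) (at 0)"
    by (rule has_derivative_compose)
  then show ?thesis by (simp add: has_vector_derivative_def f'.scaleR)
qed

text \<open>The flux is differentiable only on \<open>\<Omega>\<close>, where \<open>U > 0\<close>. Extended by zero it is continuously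
  differentiable everywhere, because it vanishes outside the compact set \<open>K\<close>, which lies in \<open>\<Omega>\<close>.\<close>

lemma integral_flux_deriv_eq_0:
  fixes V W Z :: "real ^ 4 \<Rightarrow> real ^ 4"
  assumes K: "compact K" "K \<subseteq> \<Omega>" and \<Omega>: "open \<Omega>" "\<And>x. x \<in> \<Omega> \<Longrightarrow> a\<^sup>2 * (x \<bullet> x) < 1"
    and V: "\<And>x. (V has_derivative V' x) (at x)" "\<And>x. V' x (axis i 1) = W x"
    and W: "\<And>x. (W has_derivative W' x) (at x)" "\<And>x. W' x (axis i 1) = Z x"
    and cont: "continuous_on UNIV V" "continuous_on UNIV W" "continuous_on UNIV Z"
    and supp: "\<And>x. x \<notin> K \<Longrightarrow> V x = 0" "\<And>x. x \<notin> K \<Longrightarrow> W x = 0" "\<And>x. x \<notin> K \<Longrightarrow> Z x = 0"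
  shows "integral K (\<lambda>x. flux_deriv a i x (V x) (W x) (Z x)) = 0"
    and "continuous_on \<Omega> (\<lambda>x. flux_deriv a i x (V x) (W x) (Z x))" (is "continuous_on \<Omega> ?D")
proof -
  define U where "U x = 1 - a\<^sup>2 * (x \<bullet> x)" for x :: "real ^ 4"
  define X where "X x = flux a i x (V x) (W x)" for x
  have U: "U x > 0" if "x \<in> \<Omega>" for x using \<Omega>(2)[OF that] by (simp add: U_def)
  then have U0: "\<forall>x\<in>\<Omega>. U x \<noteq> 0" by force
  note cont' [continuous_intros] = cont[THEN continuous_on_subset, OF subset_UNIV]
  have cU [continuous_intros]: "continuous_on \<Omega> U" unfolding U_def by (intro continuous_intros)
  have cX: "continuous_on \<Omega> X"
    unfolding X_def flux_def Let_def U_def[symmetric] by (intro continuous_intros) (use U0 in auto)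
  show cD: "continuous_on \<Omega> ?D"
    unfolding flux_deriv_def Let_def U_def[symmetric] by (intro continuous_intros) (use U0 in auto)
  have DX: "((\<lambda>h. X (x + h *\<^sub>R axis i 1)) has_real_derivative ?D x) (at 0)" if x: "x \<in> \<Omega>" for x
  proof -
    let ?e = "axis i 1 :: real ^ 4"
    have Id: "((\<lambda>h. x + h *\<^sub>R ?e) has_vector_derivative ?e) (at 0)"
      by (auto intro!: derivative_eq_intros simp: has_vector_derivative_def)
    have V1: "((\<lambda>h. V (x + h *\<^sub>R ?e)) has_vector_derivative W x) (at 0)"
      using has_vector_derivative_along[OF V(1), of x ?e] by (simp add: V(2))
    have W1: "((\<lambda>h. W (x + h *\<^sub>R ?e)) has_vector_derivative Z x) (at 0)"
      using has_vector_derivative_along[OF W(1), of x ?e] by (simp add: W(2))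
    note N1 = has_real_derivative_inner[OF Id Id]
    have U1: "((\<lambda>h. U (x + h *\<^sub>R ?e)) has_real_derivative - 2 * a\<^sup>2 * x $ i) (at 0)"
      unfolding U_def
      by (rule DERIV_cong[OF DERIV_diff[OF DERIV_const DERIV_cmult[OF N1]]])
         (simp add: inner_axis inner_axis')
    have N: "((\<lambda>h. (x + h *\<^sub>R ?e) \<bullet> (x + h *\<^sub>R ?e)) has_real_derivative 2 * x $ i) (at 0)"
      by (rule DERIV_cong[OF N1]) (simp add: inner_axis inner_axis')
    have p: "((\<lambda>h. (x + h *\<^sub>R ?e) \<bullet> V (x + h *\<^sub>R ?e)) has_real_derivative V x $ i + x \<bullet> W x) (at 0)"
      by (rule DERIV_cong[OF has_real_derivative_inner[OF Id V1]]) (simp add: inner_axis')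
    have q: "((\<lambda>h. (x + h *\<^sub>R ?e) \<bullet> W (x + h *\<^sub>R ?e)) has_real_derivative W x $ i + x \<bullet> Z x) (at 0)"
      by (rule DERIV_cong[OF has_real_derivative_inner[OF Id W1]]) (simp add: inner_axis')
    have xi: "((\<lambda>h. (x + h *\<^sub>R ?e) $ i) has_real_derivative 1) (at 0)"
      by (auto intro!: derivative_eq_intros)
    have Vi: "((\<lambda>h. V (x + h *\<^sub>R ?e) $ i) has_real_derivative W x $ i) (at 0)"
      using bounded_linear.has_vector_derivative[OF bounded_linear_vec_nth V1]
      by (simp add: has_real_derivative_iff_has_vector_derivative)
    note Ux = U[OF x]
    have P: "((\<lambda>h. 1 / U (x + h *\<^sub>R ?e) ^ n) has_real_derivative
        2 * a\<^sup>2 * x $ i * n / U x ^ Suc n) (at 0)" for n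
      by (rule DERIV_cong[OF DERIV_divide[OF DERIV_const DERIV_power[OF U1]]], use Ux in simp)
         (use Ux in \<open>cases n; simp add: field_simps\<close>)
    show ?thesis
      unfolding X_def flux_def flux_deriv_def Let_def U_def[symmetric]
      by (rule DERIV_cong[OF DERIV_add[OF DERIV_mult[OF P DERIV_diff[OF Vi q]]
              DERIV_mult[OF P DERIV_cmult[OF DERIV_diff[OF
                  DERIV_cmult[OF DERIV_mult[OF N Vi]] DERIV_cmult[OF DERIV_mult[OF xi p]]]]]]])
         (use Ux in \<open>simp add: divide_simps, simp add: algebra_simps eval_nat_numeral\<close>)
  qed
  define f where "f x = (if x \<in> \<Omega> then X x else 0)" for x
  define f' where "f' x = (if x \<in> \<Omega> then ?D x else 0)" for x
  have fK: "f x = 0" "f' x = 0" if "x \<notin> K" for x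
    using that supp by (simp_all add: f_def f'_def X_def flux_def flux_deriv_def)
  have UN: "\<Omega> \<union> (- K) = UNIV" using K by auto
  have oK: "open (- K)" using K by (simp add: compact_imp_closed open_Compl)
  have "integral K f' = 0"
  proof (rule integral_directional_derivative_eq_0[OF K(1) fK(1)])
    fix x :: "real ^ 4"
    have line: "open ((\<lambda>h::real. x + h *\<^sub>R axis i 1) -` S)" if "open S" for S
      by (intro open_vimage that continuous_intros)
    show "((\<lambda>h. f (x + h *\<^sub>R axis i 1)) has_real_derivative f' x) (at 0)"
    proof (cases "x \<in> \<Omega>")
      case True
      then show ?thesis unfolding f'_def
        using has_field_derivative_transform_within_open[OF DX[OF True] line[OF \<Omega>(1)], of "\<lambda>h. f (x + h *\<^sub>R axis i 1)"]
        by (simp add: f_def)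
    next
      case False
      then have "x \<notin> K" using K by auto
      then show ?thesis
        using has_field_derivative_transform_within_open[OF DERIV_const line[OF oK], of "0::real" 0 "\<lambda>h. f (x + h *\<^sub>R axis i 1)"]
        by (simp add: fK)
    qed
  next
    have "continuous_on \<Omega> f" using cX by (simp add: f_def cong: continuous_on_cong)
    moreover have "continuous_on (- K) f" by (rule continuous_on_eq[OF continuous_on_const[of _ 0]]) (simp add: fK)
    ultimately show "continuous_on UNIV f" using continuous_on_open_Un[OF \<Omega>(1) oK] UN by metis
    have "continuous_on \<Omega> f'" using cD by (simp add: f'_def cong: continuous_on_cong)
    moreover have "continuous_on (- K) f'" by (rule continuous_on_eq[OF continuous_on_const[of _ 0]]) (simp add: fK)
    ultimately show "continuous_on UNIV f'" using continuous_on_open_Un[OF \<Omega>(1) oK] UN by metis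
  qed
  moreover have "integral K f' = integral K ?D"
    by (rule integral_cong) (use K in \<open>auto simp: f'_def\<close>)
  ultimately show "integral K ?D = 0" by simp
qed

text \<open>By compactness \<open>\<phi>\<close> keeps a positive distance from the boundary of the unit ball on \<open>K\<close>, and \<open>V\<close> is
  bounded there. The density is singular on the boundary, so differentiation under the integral
  needs a uniform interval of parameters.\<close>

lemma variation_stays_in_ball:
  fixes \<phi> V :: "'a::euclidean_space \<Rightarrow> 'b::euclidean_space"
  assumes K: "compact K" and c: "continuous_on K \<phi>" "continuous_on K V"
    and 1: "\<And>x. x \<in> K \<Longrightarrow> norm (\<phi> x) < 1"
  obtains \<epsilon> where "\<epsilon> > 0" "\<And>s x. s \<in> {-\<epsilon>..\<epsilon>} \<Longrightarrow> x \<in> K \<Longrightarrow> norm (\<phi> x + s *\<^sub>R V x) < 1"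
proof -
  have "\<exists>M<1. \<forall>x\<in>K. norm (\<phi> x) \<le> M"
  proof (cases "K = {}")
    case False
    then obtain x0 where "x0 \<in> K" "\<forall>x\<in>K. norm (\<phi> x) \<le> norm (\<phi> x0)"
      using continuous_attains_sup[OF K False, of "\<lambda>x. norm (\<phi> x)"] c by (auto intro: continuous_intros)
    then show ?thesis using 1 by blast
  qed (auto intro: exI[of _ 0])
  then obtain M where M: "M < 1" "\<And>x. x \<in> K \<Longrightarrow> norm (\<phi> x) \<le> M" by blast
  have "bounded (V ` K)" by (intro compact_imp_bounded compact_continuous_image K c)
  then obtain N where N: "N > 0" "\<And>x. x \<in> K \<Longrightarrow> norm (V x) \<le> N" by (auto simp: bounded_pos)
  show ?thesis
  proof (rule that[of "(1 - M) / (2 * N)"])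
    show "(1 - M) / (2 * N) > 0" using M N by simp
    fix s x assume s: "s \<in> {- ((1 - M) / (2 * N))..(1 - M) / (2 * N)}" and x: "x \<in> K"
    have "norm (\<phi> x + s *\<^sub>R V x) \<le> norm (\<phi> x) + norm (s *\<^sub>R V x)" by (rule norm_triangle_ineq)
    also have "\<dots> \<le> M + (1 - M) / (2 * N) * N"
      unfolding norm_scaleR using s x M N by (intro add_mono mult_mono) auto
    also have "\<dots> < 1" using M N by (simp add: field_simps)
    finally show "norm (\<phi> x + s *\<^sub>R V x) < 1" .
  qed
qed

text \<open>The energy of \<open>\<phi> + s V\<close> is differentiated under the integral; the resulting integrand is a
  divergence by \<open>hyp_density_var_scaling\<close>.\<close>

lemma biharmonic_scaling:
  assumes d: "d \<noteq> 0" and \<Omega>: "open \<Omega>" and \<phi>: "\<And>x. x \<in> \<Omega> \<Longrightarrow> \<phi> x = a *\<^sub>R x"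
    and 1: "\<And>x. x \<in> \<Omega> \<Longrightarrow> norm (a *\<^sub>R x) < 1"
  shows "biharmonic (hyp_metric d) \<Omega> hyp_space \<phi>"
  unfolding biharmonic_def
proof (intro conjI allI impI)
  show "smooth_on \<Omega> \<phi>" by (rule smooth_on_scaling[OF \<Omega> \<phi>])
  show "\<phi> ` \<Omega> \<subseteq> hyp_space" using \<phi> 1 by (auto simp: hyp_space_def)
  fix K V assume K\<Omega>: "K \<subseteq> \<Omega>" and test: "test_function K (V :: real ^ 4 \<Rightarrow> real ^ 4)"
  have K: "compact K" using test by (simp add: test_function_def)
  obtain W Z where V: "\<And>x. (V has_derivative frechet_derivative V (at x)) (at x)"
      "\<And>i x. frechet_derivative V (at x) (axis i 1) = W i x"
    and W: "\<And>i x. (W i has_derivative frechet_derivative (W i) (at x)) (at x)"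
      "\<And>i x. frechet_derivative (W i) (at x) (axis i 1) = Z i x"
    and cont: "continuous_on UNIV V" "\<And>i. continuous_on UNIV (W i)" "\<And>i. continuous_on UNIV (Z i)"
    and supp: "\<And>x. x \<notin> K \<Longrightarrow> V x = 0" "\<And>i x. x \<notin> K \<Longrightarrow> W i x = 0" "\<And>i x. x \<notin> K \<Longrightarrow> Z i x = 0"
    using test_function_partials[OF test] by blast
  define y where "y s x = a *\<^sub>R x + s *\<^sub>R V x" for s x
  define A where "A s x i = a *\<^sub>R axis i 1 + s *\<^sub>R W i x" for s x i
  define L where "L s x = s *\<^sub>R (\<Sum>i\<in>UNIV. Z i x)" for s x
  obtain \<epsilon> where \<epsilon>: "\<epsilon> > 0" "\<And>s x. s \<in> {-\<epsilon>..\<epsilon>} \<Longrightarrow> x \<in> K \<Longrightarrow> norm (y s x) < 1"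
    unfolding y_def
    by (rule variation_stays_in_ball[OF K, of "\<lambda>x. a *\<^sub>R x" V])
       (use 1 K\<Omega> continuous_on_subset[OF cont(1) subset_UNIV] in \<open>auto intro!: continuous_intros\<close>)
  have y1: "y s x \<bullet> y s x < 1" if "s \<in> {-\<epsilon>..\<epsilon>}" "x \<in> K" for s x
    using \<epsilon>(2)[OF that] by (simp add: norm_lt_1_inner)
  have energy: "bienergy (hyp_metric d) K (\<lambda>x. \<phi> x + s *\<^sub>R V x)
      = 1/2 * integral K (\<lambda>x. hyp_density d (y s x) (A s x) (L s x))"
    if s: "s \<in> {-\<epsilon>..\<epsilon>}" for s
  proof -
    have "metric_inner (hyp_metric d) (\<phi> x + s *\<^sub>R V x)
          (tension (hyp_metric d) (\<lambda>x. \<phi> x + s *\<^sub>R V x) x)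
          (tension (hyp_metric d) (\<lambda>x. \<phi> x + s *\<^sub>R V x) x)
        = hyp_density d (y s x) (A s x) (L s x)" if x: "x \<in> K" for x
    proof -
      have x\<Omega>: "x \<in> \<Omega>" using x K\<Omega> by auto
      have yx: "\<phi> x + s *\<^sub>R V x = y s x" by (simp add: y_def \<phi> x\<Omega>)
      have "tension (hyp_metric d) (\<lambda>x. \<phi> x + s *\<^sub>R V x) x
          = hyp_tension (\<phi> x + s *\<^sub>R V x) (\<lambda>i. A s x i) (\<Sum>i\<in>UNIV. s *\<^sub>R Z i x)"
      proof (rule tension_hyp[where A="\<lambda>i x. A s x i", OF d \<Omega> x\<Omega>])
        show "norm (\<phi> x + s *\<^sub>R V x) < 1" unfolding yx by (rule \<epsilon>(2)[OF s x])
      next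
        fix z i assume z: "z \<in> \<Omega>"
        have "((\<lambda>x. a *\<^sub>R x + s *\<^sub>R V x) has_derivative
            (\<lambda>h. a *\<^sub>R h + s *\<^sub>R frechet_derivative V (at z) h)) (at z)"
          by (intro derivative_intros V(1))
        then have "((\<lambda>x. \<phi> x + s *\<^sub>R V x) has_derivative
            (\<lambda>h. a *\<^sub>R h + s *\<^sub>R frechet_derivative V (at z) h)) (at z)"
          by (rule has_derivative_transform_within_open[OF _ \<Omega> z]) (simp add: \<phi>)
        then show "\<exists>D. ((\<lambda>x. \<phi> x + s *\<^sub>R V x) has_derivative D) (at z) \<and> D (axis i 1) = A s z i"
          by - (rule exI, erule conjI, simp add: A_def V(2))
      next
        fix i
        have "((\<lambda>x. A s x i) has_derivative (\<lambda>h. 0 + s *\<^sub>R frechet_derivative (W i) (at x) h)) (at x)"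
          unfolding A_def by (intro derivative_intros W(1))
        then show "\<exists>D. ((\<lambda>x. A s x i) has_derivative D) (at x) \<and> D (axis i 1) = s *\<^sub>R Z i x"
          by - (rule exI, erule conjI, simp add: W(2))
      qed
      then have "tension (hyp_metric d) (\<lambda>x. \<phi> x + s *\<^sub>R V x) x = hyp_tension (y s x) (A s x) (L s x)"
        unfolding yx by (simp add: L_def scaleR_sum_right)
      then show ?thesis unfolding yx metric_inner_hyp hyp_density_def by simp
    qed
    then show ?thesis unfolding bienergy_def by (simp cong: integral_cong)
  qed
  define G' where "G' s x = hyp_density_var d (y s x) (A s x) (L s x)
      (V x) (\<lambda>i. W i x) (\<Sum>i\<in>UNIV. Z i x)" for s x
  have V_cont: "continuous_on S (\<lambda>p. V (snd p))" "continuous_on S (\<lambda>p. W i (snd p))"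
    "continuous_on S (\<lambda>p. Z i (snd p))" for S :: "(real \<times> (real ^ 4)) set" and i
    by (rule continuous_on_compose2[OF cont(1)] continuous_on_compose2[OF cont(2)]
        continuous_on_compose2[OF cont(3)]; auto intro: continuous_intros)+
  have jet_cont: "continuous_on S (\<lambda>p. y (fst p) (snd p))"
    "continuous_on S (\<lambda>p. A (fst p) (snd p) i)" "continuous_on S (\<lambda>p. L (fst p) (snd p))" for S i
    unfolding y_def A_def L_def by (intro continuous_intros V_cont)+
  have u_nz: "y (fst p) (snd p) \<bullet> y (fst p) (snd p) \<noteq> 1" if "p \<in> {-\<epsilon>..\<epsilon>} \<times> K" for p
    using y1[of "fst p" "snd p"] that by (cases p) simp
  have "((\<lambda>s. integral K (\<lambda>x. hyp_density d (y s x) (A s x) (L s x))) has_real_derivative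
      integral K (G' 0)) (at 0 within {-\<epsilon>..\<epsilon>})"
  proof (rule has_real_derivative_integral_compact[OF K])
    fix s assume s: "s \<in> {-\<epsilon>..\<epsilon>}"
    have "continuous_on ({-\<epsilon>..\<epsilon>} \<times> K)
        (\<lambda>p. hyp_density d (y (fst p) (snd p)) (A (fst p) (snd p)) (L (fst p) (snd p)))"
      unfolding hyp_density_def hyp_tension_def hyp_quad_def
      by (intro continuous_intros jet_cont ballI) (simp_all add: d u_nz)
    from continuous_on_compose2[OF this, of K "Pair s"] s
    show "continuous_on K (\<lambda>x. hyp_density d (y s x) (A s x) (L s x))"
      by (simp add: continuous_on_Pair image_subset_iff)
  next
    show "continuous_on ({-\<epsilon>..\<epsilon>} \<times> K) (\<lambda>(s, x). G' s x)"
      unfolding G'_def hyp_density_var_def hyp_tension_var_def hyp_tension_def hyp_quad_def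
        hyp_quad_var_def case_prod_unfold
      by (intro continuous_intros jet_cont V_cont ballI) (simp_all add: d u_nz)
  next
    fix s x assume sx: "s \<in> {-\<epsilon>..\<epsilon>}" "x \<in> K"
    have line: "((\<lambda>s. p + s *\<^sub>R q) has_vector_derivative q) (at s)" for p q :: "real ^ 4"
      by (auto intro!: derivative_eq_intros simp: has_vector_derivative_def)
    have y': "((\<lambda>s. y s x) has_vector_derivative V x) (at s)" unfolding y_def by (rule line)
    have A': "((\<lambda>s. A s x i) has_vector_derivative W i x) (at s)" for i unfolding A_def by (rule line)
    have L': "((\<lambda>s. L s x) has_vector_derivative (\<Sum>i\<in>UNIV. Z i x)) (at s)"
      using line[of 0 "\<Sum>i\<in>UNIV. Z i x"] unfolding L_def add_0 .
    show "((\<lambda>s. hyp_density d (y s x) (A s x) (L s x)) has_real_derivative G' s x)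
        (at s within {-\<epsilon>..\<epsilon>})"
      unfolding G'_def
      by (rule has_field_derivative_at_within,
          rule hyp_density_has_derivative[where y="\<lambda>s. y s x" and A="\<lambda>s. A s x" and L="\<lambda>s. L s x"])
         (rule d y1[OF sx] y' A' L')+
  qed (use \<epsilon> in auto)
  then have D: "((\<lambda>s. 1/2 * integral K (\<lambda>x. hyp_density d (y s x) (A s x) (L s x))) has_real_derivative
      1/2 * integral K (G' 0)) (at 0)"
    using at_within_Icc_at[of "-\<epsilon>" 0 \<epsilon>] \<epsilon>(1) by (auto intro: DERIV_cdivide)
  have "integral K (G' 0) = 0"
  proof -
    have lt1: "a\<^sup>2 * (x \<bullet> x) < 1" if "x \<in> \<Omega>" for x
      using 1[OF that] unfolding norm_lt_1_inner by (simp add: power2_eq_square)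
    have zero: "integral K (\<lambda>x. flux_deriv a i x (V x) (W i x) (Z i x)) = 0"
        "continuous_on \<Omega> (\<lambda>x. flux_deriv a i x (V x) (W i x) (Z i x))" for i
      by (rule integral_flux_deriv_eq_0[where V=V and W="W i" and Z="Z i",
            OF K K\<Omega> \<Omega> lt1 V W cont supp]; assumption)+
    have "integral K (G' 0)
        = integral K (\<lambda>x. 32 * a ^ 3 / d\<^sup>2 * (\<Sum>i\<in>UNIV. flux_deriv a i x (V x) (W i x) (Z i x)))"
    proof (rule integral_cong)
      fix x assume x: "x \<in> K"
      have A0: "A 0 x = (\<lambda>i. a *\<^sub>R axis i 1)" by (simp add: A_def fun_eq_iff)
      have "1 - a\<^sup>2 * (x \<bullet> x) \<noteq> 0" using lt1[OF subsetD[OF K\<Omega> x]] by linarith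
      from hyp_density_var_scaling[OF this d, of "V x" "\<lambda>i. W i x" "\<lambda>i. Z i x"]
      show "G' 0 x = 32 * a ^ 3 / d\<^sup>2 * (\<Sum>i\<in>UNIV. flux_deriv a i x (V x) (W i x) (Z i x))"
        unfolding G'_def y_def L_def A0 scaleR_zero_left add_0_right .
    qed
    also have "\<dots> = 32 * a ^ 3 / d\<^sup>2 * (\<Sum>i\<in>UNIV. integral K (\<lambda>x. flux_deriv a i x (V x) (W i x) (Z i x)))"
    proof -
      have int: "(\<lambda>x. flux_deriv a i x (V x) (W i x) (Z i x)) integrable_on K" for i
        by (rule integrable_on_compact[OF K continuous_on_subset[OF zero(2) K\<Omega>]])
      have "integral K (\<lambda>x. \<Sum>i\<in>UNIV. flux_deriv a i x (V x) (W i x) (Z i x))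
          = (\<Sum>i\<in>UNIV. integral K (\<lambda>x. flux_deriv a i x (V x) (W i x) (Z i x)))"
        by (rule integral_sum) (simp_all add: int)
      then show ?thesis by (simp only: integral_mult_right)
    qed
    also have "\<dots> = 0" by (simp only: zero(1) sum.neutral_const mult_zero_right)
    finally show ?thesis .
  qed
  with D have D0: "((\<lambda>s. 1/2 * integral K (\<lambda>x. hyp_density d (y s x) (A s x) (L s x)))
      has_real_derivative 0) (at 0)" by simp
  show "((\<lambda>s. bienergy (hyp_metric d) K (\<lambda>x. \<phi> x + s *\<^sub>R V x)) has_real_derivative 0) (at 0)"
    by (rule has_field_derivative_transform_within_open[OF D0, of "{-\<epsilon><..<\<epsilon>}"])
       (use \<epsilon>(1) energy in auto)
qed

section \<open>The equivariant second variation\<close>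

lemma hfun_has_derivative: "d \<noteq> 0 \<Longrightarrow> (hfun d has_real_derivative cosh (d * a)) (at a)"
  unfolding hfun_def by (auto intro!: derivative_eq_intros)

lemma qfun_eq:
  assumes "d \<noteq> 0"
  shows "qfun d a = sinh (2 * d * a) / (2 * d)"
  using DERIV_imp_deriv[OF hfun_has_derivative[OF assms, of a]] sinh_double[of "d * a"]
  by (simp add: qfun_def hfun_def mult.assoc)

text \<open>The equation \<open>\<beta>' = h(\<beta>)\<close> says that the rotationally symmetric map is conformal. With
  \<open>T s\<close> the integrand before squaring, the second derivative of the energy is the integral of
  \<open>(T')\<^sup>2 + T T''\<close>. The sign of \<open>T T''\<close> at \<open>s = 0\<close> is decisive: \<open>T\<close> has the sign of \<open>- \<beta>\<close>, since
  \<open>cosh > 1\<close> away from zero, and \<open>T'' = - 3 q''(\<beta>) V\<^sup>2\<close> has, where \<open>V\<close> does not vanish, the same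
  sign because \<open>q''\<close> is a positive multiple of \<open>sinh (2 d \<beta>)\<close>.\<close>

lemma second_variation_pos:
  fixes \<beta> V :: "real \<Rightarrow> real"
  assumes d: "d > 0" and I: "open I"
    and \<beta>: "\<And>t. t \<in> I \<Longrightarrow> (\<beta> has_real_derivative hfun d (\<beta> t)) (at t)"
    and \<beta>0: "\<And>t. t \<in> I \<Longrightarrow> \<beta> t \<noteq> 0"
    and KI: "K \<subseteq> I" and test: "test_function K V" and t0: "V t0 \<noteq> 0"
  shows "second_deriv_pos (\<lambda>s. E2 d K (\<lambda>t. \<beta> t + s * V t))"
proof -
  have K: "compact K" and VC: "\<And>k. C_k k UNIV V" and supp: "\<And>t. t \<notin> K \<Longrightarrow> V t = 0"
    using test by (auto simp: test_function_def smooth_on_def)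
  note WC = C_k_Suc_real(2)[OF VC] and ZC = C_k_Suc_real(2)[OF C_k_Suc_real(2)[OF VC]]
  define W where "W = deriv V"
  define Z where "Z = deriv (deriv V)"
  have V1: "(V has_real_derivative W t) (at t)" for t unfolding W_def by (rule C_k_Suc_real(1)[OF VC])
  have W1: "(W has_real_derivative Z t) (at t)" for t
    unfolding W_def Z_def by (rule C_k_Suc_real(1)[OF WC])
  have cont: "continuous_on UNIV V" "continuous_on UNIV W" "continuous_on UNIV Z"
    using VC[of 0] WC[of 0] ZC[of 0] by (simp_all add: W_def Z_def)
  have c\<beta>: "continuous_on K \<beta>"
    using \<beta> KI by (intro DERIV_continuous_on) (auto intro: has_field_derivative_at_within)
  define T where "T s t = qfun d (\<beta> t) + 2 * hfun d (\<beta> t) + s * (Z t + 2 * W t)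
      - 3 * (sinh (2 * d * (\<beta> t + s * V t)) / (2 * d))" for s t
  define T1 where "T1 s t = Z t + 2 * W t - 3 * cosh (2 * d * (\<beta> t + s * V t)) * V t" for s t
  define T2 where "T2 s t = - 6 * d * sinh (2 * d * (\<beta> t + s * V t)) * (V t)\<^sup>2" for s t
  have E2: "E2 d K (\<lambda>t. \<beta> t + s * V t) = 1/2 * integral K (\<lambda>t. (T s t)\<^sup>2)" for s
  proof -
    have "deriv (deriv (\<lambda>t. \<beta> t + s * V t)) t + 2 * deriv (\<lambda>t. \<beta> t + s * V t) t
        - 3 * qfun d (\<beta> t + s * V t) = T s t" if t: "t \<in> K" for t
    proof -
      have 1: "deriv (\<lambda>t. \<beta> t + s * V t) t = hfun d (\<beta> t) + s * W t" if "t \<in> I" for t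
        using \<beta>[OF that] V1[of t] by (intro DERIV_imp_deriv) (auto intro!: derivative_eq_intros)
      have tI: "t \<in> I" using t KI by auto
      have "((\<lambda>t. hfun d (\<beta> t) + s * W t) has_real_derivative
          cosh (d * \<beta> t) * hfun d (\<beta> t) + s * Z t) (at t)"
        by (intro DERIV_add DERIV_cmult W1 DERIV_chain2[OF hfun_has_derivative \<beta>] tI) (use d in simp)
      then have "(deriv (\<lambda>t. \<beta> t + s * V t) has_real_derivative
          cosh (d * \<beta> t) * hfun d (\<beta> t) + s * Z t) (at t)"
        by (rule has_field_derivative_transform_within_open[OF _ I tI]) (simp add: 1)
      \<comment> \<open>The first summand is \<open>h'(\<beta>) h(\<beta>)\<close>, which is \<open>q(\<beta>)\<close>.\<close>
      then have 2: "deriv (deriv (\<lambda>t. \<beta> t + s * V t)) t = qfun d (\<beta> t) + s * Z t"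
        using DERIV_imp_deriv DERIV_imp_deriv[OF hfun_has_derivative[of d "\<beta> t"]] d
        by (simp add: qfun_def mult.commute)
      have q: "qfun d (\<beta> t + s * V t) = sinh (2 * d * (\<beta> t + s * V t)) / (2 * d)"
        using d by (simp add: qfun_eq)
      show ?thesis unfolding 1[OF tI] 2 q T_def by (simp add: algebra_simps)
    qed
    then show ?thesis unfolding E2_def by (simp cong: integral_cong)
  qed
  have T': "((\<lambda>s. T s t) has_real_derivative T1 s t) (at s)" for s t
    unfolding T_def T1_def using d by (auto intro!: derivative_eq_intros)
  have T1': "((\<lambda>s. T1 s t) has_real_derivative T2 s t) (at s)" for s t
    unfolding T1_def T2_def by (auto intro!: derivative_eq_intros simp: power2_eq_square)
  have V_cont: "continuous_on ({-1..1} \<times> K) (\<lambda>p::real \<times> real. V (snd p))"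
    "continuous_on ({-1..1} \<times> K) (\<lambda>p::real \<times> real. W (snd p))"
    "continuous_on ({-1..1} \<times> K) (\<lambda>p::real \<times> real. Z (snd p))"
    "continuous_on ({-1..1} \<times> K) (\<lambda>p::real \<times> real. \<beta> (snd p))"
    by (rule continuous_on_compose2[OF cont(1)] continuous_on_compose2[OF cont(2)]
        continuous_on_compose2[OF cont(3)] continuous_on_compose2[OF c\<beta>]; auto intro: continuous_intros)+
  have cT: "continuous_on ({-1..1} \<times> K) (\<lambda>p. T (fst p) (snd p))"
    unfolding T_def hfun_def qfun_eq[OF less_imp_neq[OF d, symmetric]]
    by (intro continuous_intros V_cont ballI) (use d in simp_all)
  have cT1: "continuous_on ({-1..1} \<times> K) (\<lambda>p. T1 (fst p) (snd p))"
    unfolding T1_def by (intro continuous_intros V_cont)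
  have cT2: "continuous_on ({-1..1} \<times> K) (\<lambda>p. T2 (fst p) (snd p))"
    unfolding T2_def by (intro continuous_intros V_cont)
  have sl: "continuous_on K (f s)" if "continuous_on ({-1..1} \<times> K) (\<lambda>p. f (fst p) (snd p))" "s \<in> {-1..1}"
    for f :: "real \<Rightarrow> real \<Rightarrow> real" and s
    using continuous_on_compose2[OF that(1), of K "Pair s"] that(2)
    by (simp add: continuous_on_Pair image_subset_iff)
  have D1: "((\<lambda>s. integral K (\<lambda>t. (T s t)\<^sup>2)) has_real_derivative
      integral K (\<lambda>t. 2 * T s t * T1 s t)) (at s within {-1..1})" if "s \<in> {-1..1}" for s
  proof (rule has_real_derivative_integral_compact[OF K _ _ _ that])
    fix s t assume "s \<in> {-1..1::real}"
    then show "continuous_on K (\<lambda>t. (T s t)\<^sup>2)" by (intro continuous_intros sl[OF cT])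
    show "((\<lambda>s. (T s t)\<^sup>2) has_real_derivative 2 * T s t * T1 s t) (at s within {-1..1})"
      by (rule has_field_derivative_at_within, rule DERIV_cong[OF DERIV_power[OF T']]) simp
  qed (unfold case_prod_unfold, intro continuous_on_mult continuous_on_const cT cT1)
  have D2: "((\<lambda>s. integral K (\<lambda>t. 2 * T s t * T1 s t)) has_real_derivative
      integral K (\<lambda>t. 2 * ((T1 s t)\<^sup>2 + T s t * T2 s t))) (at s within {-1..1})" if "s \<in> {-1..1}" for s
  proof (rule has_real_derivative_integral_compact[OF K _ _ _ that])
    fix s t assume "s \<in> {-1..1::real}"
    then show "continuous_on K (\<lambda>t. 2 * T s t * T1 s t)" by (intro continuous_intros sl[OF cT] sl[OF cT1])
    show "((\<lambda>s. 2 * T s t * T1 s t) has_real_derivative 2 * ((T1 s t)\<^sup>2 + T s t * T2 s t))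
        (at s within {-1..1})"
      by (rule has_field_derivative_at_within, rule DERIV_cong[OF DERIV_mult[OF DERIV_cmult[OF T'] T1']])
         (simp add: power2_eq_square algebra_simps)
  qed (unfold case_prod_unfold, intro continuous_on_mult continuous_on_add continuous_on_power
      continuous_on_const cT cT1 cT2)
  have key: "T 0 t * T2 0 t = 24 * (sinh (d * \<beta> t))\<^sup>2 * cosh (d * \<beta> t) * (cosh (d * \<beta> t) - 1) * (V t)\<^sup>2" for t
  proof -
    define S where "S = sinh (d * \<beta> t)"
    define C where "C = cosh (d * \<beta> t)"
    have S2: "sinh (2 * d * \<beta> t) = 2 * S * C"
      unfolding S_def C_def using sinh_double[of "d * \<beta> t"] by (simp only: mult.assoc)
    have "T 0 t = 2 * S * (1 - C) / d"
      using d unfolding T_def by (simp add: qfun_eq S2) (simp add: hfun_def S_def field_simps)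
    moreover have "T2 0 t = - 12 * d * S * C * (V t)\<^sup>2"
      unfolding T2_def by (simp add: S2)
    ultimately show ?thesis
      using d unfolding S_def[symmetric] C_def[symmetric] by (simp add: power2_eq_square)
        (simp add: algebra_simps)
  qed
  define D where "D = integral K (\<lambda>t. (T1 0 t)\<^sup>2 + T 0 t * T2 0 t)"
  have "D > 0"
    unfolding D_def
  proof (rule integral_compact_pos[OF K _ _ _ _ _ ])
    show "continuous_on K (\<lambda>t. (T1 0 t)\<^sup>2 + T 0 t * T2 0 t)"
      by (intro continuous_intros sl[OF cT] sl[OF cT1] sl[OF cT2]) auto
    show "(T1 0 t)\<^sup>2 + T 0 t * T2 0 t \<ge> 0" for t
      unfolding key using cosh_real_ge_1[of "d * \<beta> t"] by (intro add_nonneg_nonneg mult_nonneg_nonneg) auto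
    show "open {t. V t \<noteq> 0}" using cont(1) by (intro open_Collect_neq) auto
    show "{t. V t \<noteq> 0} \<subseteq> K" using supp by auto
    show "t0 \<in> {t. V t \<noteq> 0}" using t0 by simp
    have "t0 \<in> I" using t0 supp KI by auto
    then have "d * \<beta> t0 \<noteq> 0" using \<beta>0 d by simp
    then have "sinh (d * \<beta> t0) \<noteq> 0" "cosh (d * \<beta> t0) > 1"
      using cosh_real_ge_1[of "d * \<beta> t0"] by (simp_all add: order_less_le)
    then have "T 0 t0 * T2 0 t0 > 0" unfolding key using t0 by (intro mult_pos_pos) auto
    then show "(T1 0 t0)\<^sup>2 + T 0 t0 * T2 0 t0 \<noteq> 0" using zero_le_power2[of "T1 0 t0"] by linarith
  qed
  show ?thesis
    unfolding second_deriv_pos_def E2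
  proof (intro exI conjI)
    show "\<forall>\<^sub>F s in nhds 0. ((\<lambda>s. 1/2 * integral K (\<lambda>t. (T s t)\<^sup>2)) has_real_derivative
        1/2 * integral K (\<lambda>t. 2 * T s t * T1 s t)) (at s)"
      unfolding eventually_nhds
    proof (intro exI[of _ "{-1<..<1}"] conjI ballI)
      fix s :: real assume "s \<in> {-1<..<1}"
      then show "((\<lambda>s. 1/2 * integral K (\<lambda>t. (T s t)\<^sup>2)) has_real_derivative
        1/2 * integral K (\<lambda>t. 2 * T s t * T1 s t)) (at s)"
        using D1[of s] at_within_Icc_at[of "-1" s 1] by (auto intro: DERIV_cdivide)
    qed auto
    show "((\<lambda>s. 1/2 * integral K (\<lambda>t. 2 * T s t * T1 s t)) has_real_derivative D) (at 0)"
    proof -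
      have "1/2 * integral K (\<lambda>t. 2 * ((T1 0 t)\<^sup>2 + T 0 t * T2 0 t)) = D"
        unfolding D_def integral_mult_right by simp
      then show ?thesis
        using DERIV_cmult[OF D2[of 0], of "1/2"] at_within_Icc_at[of "-1" 0 "1::real"]
        by (simp del: integral_mult_right)
    qed
  qed (rule \<open>D > 0\<close>)
qed

lemma tanh_artanh_real:
  assumes "\<bar>x\<bar> < 1" shows "tanh (artanh x) = (x::real)"
proof -
  define z where "z = (1 + x) / (1 - x)"
  have z: "z > 0" using assms by (simp add: z_def)
  have "tanh (artanh x) = tanh (ln (sqrt z))"
    using z by (simp add: artanh_def z_def[symmetric] ln_sqrt)
  also have "\<dots> = (z - 1) / (z + 1)" using z by (subst tanh_ln_real) simp_all
  also have "\<dots> = x" using assms by (simp add: z_def field_simps)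
  finally show ?thesis .
qed

lemma sinh_2_artanh_real:
  assumes "\<bar>x\<bar> < 1" shows "sinh (2 * artanh x) = 2 * x / (1 - x\<^sup>2 :: real)"
proof -
  define C where "C = cosh (artanh x)"
  define S where "S = sinh (artanh x)"
  have C: "C > 0" by (simp add: C_def)
  have SC: "S = x * C" using tanh_artanh_real[OF assms] C unfolding tanh_def S_def C_def
    by (simp add: field_simps)
  have "C\<^sup>2 - S\<^sup>2 = 1" unfolding C_def S_def by (rule hyperbolic_pythagoras)
  then have C2: "C\<^sup>2 * (1 - x\<^sup>2) = 1" unfolding SC by (simp add: algebra_simps)
  have "sinh (2 * artanh x) = 2 * x * C\<^sup>2"
    using sinh_double[of "artanh x"] by (simp add: S_def[symmetric] C_def[symmetric] SC power2_eq_square)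
  moreover have "C\<^sup>2 = 1 / (1 - x\<^sup>2)" using C2 by (metis eq_divide_eq mult_zero_right zero_neq_one)
  ultimately show ?thesis by simp
qed

section \<open>Equivariant stability\<close>

theorem theorem5p3:
  fixes c d :: real and \<beta> :: "real \<Rightarrow> real"
  assumes "c > 0" and "d > 0"
    and "\<And>t. t < ln (1 / c\<^sup>2) \<Longrightarrow> \<beta> t = 2 / d * artanh (c\<^sup>2 * exp t)"
  shows "conformal_diffeomorphism (hyp_metric d) (ball 0 (1 / c\<^sup>2)) hyp_space (rot_map d \<beta>)
       \<and> proper_biharmonic (hyp_metric d) (ball 0 (1 / c\<^sup>2)) hyp_space (rot_map d \<beta>)
       \<and> equivariant_stable d (1 / c\<^sup>2) \<beta>"
proof -
  let ?B = "ball (0 :: real ^ 4) (1 / c\<^sup>2)" and ?I = "{..<ln (1 / c\<^sup>2)}"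
  have c2: "c\<^sup>2 > 0" using assms(1) by simp
  have d0: "d \<noteq> 0" using assms(2) by simp
  have \<rho>: "0 < c\<^sup>2 * exp t" "c\<^sup>2 * exp t < 1" if "t \<in> ?I" for t
  proof -
    have "exp t < exp (ln (1 / c\<^sup>2))" using that by simp
    also have "\<dots> = 1 / c\<^sup>2" using c2 by simp
    finally show "c\<^sup>2 * exp t < 1" using c2 by (simp add: field_simps)
  qed (use c2 in simp)
  have \<phi>: "rot_map d \<beta> x = c\<^sup>2 *\<^sub>R x" if x: "x \<in> ?B" for x
  proof (cases "x = 0")
    case False
    then have "norm x > 0" by simp
    moreover have "ln (norm x) \<in> ?I" using x False c2 by (simp del: ln_div)
    ultimately show ?thesis
      using \<rho>[of "ln (norm x)"] assms(3)[of "ln (norm x)"] d0 False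
      by (simp add: rot_map_def hyp_polar_def tanh_artanh_real del: ln_div)
  qed (simp add: rot_map_def)
  have lt1: "norm (c\<^sup>2 *\<^sub>R x) < 1" if "x \<in> ?B" for x
    using that c2 by (simp add: field_simps)
  have biharm: "biharmonic (hyp_metric d) ?B hyp_space (rot_map d \<beta>)"
    by (rule biharmonic_scaling[OF d0 open_ball \<phi> lt1])
  have "\<exists>x\<in>?B. tension (hyp_metric d) (rot_map d \<beta>) x \<noteq> 0"
  proof
    \<comment> \<open>Any point of the ball other than the centre serves.\<close>
    let ?x = "(1 / (2 * c\<^sup>2)) *\<^sub>R axis 1 1 :: real ^ 4"
    show x: "?x \<in> ?B" using c2 by (simp add: norm_axis_1 field_simps)
    have "?x \<noteq> 0" using assms(1) by (simp add: axis_eq_0_iff)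
    moreover have "1 - (c\<^sup>2)\<^sup>2 * (?x \<bullet> ?x) \<noteq> 0"
      using assms(1) by (simp add: power2_eq_square)
    moreover have "tension (hyp_metric d) (rot_map d \<beta>) ?x
        = (- 4 * (c\<^sup>2) ^ 3 / (1 - (c\<^sup>2)\<^sup>2 * (?x \<bullet> ?x))) *\<^sub>R ?x"
      by (rule tension_scaling[OF d0 open_ball x \<phi> lt1[OF x]])
    ultimately show "tension (hyp_metric d) (rot_map d \<beta>) ?x \<noteq> 0"
      using assms(1) by (simp only: scaleR_eq_0_iff divide_eq_0_iff) simp
  qed
  with biharm have proper: "proper_biharmonic (hyp_metric d) ?B hyp_space (rot_map d \<beta>)"
    by (simp add: proper_biharmonic_def)
  have \<beta>': "(\<beta> has_real_derivative hfun d (\<beta> t)) (at t)" if t: "t \<in> ?I" for t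
  proof -
    have r: "\<bar>c\<^sup>2 * exp t\<bar> < 1" using \<rho>[OF t] by simp
    have "((\<lambda>t. 2 / d * artanh (c\<^sup>2 * exp t)) has_real_derivative
        2 / d * (1 / (1 - (c\<^sup>2 * exp t)\<^sup>2) * (c\<^sup>2 * exp t))) (at t)"
      by (intro DERIV_cmult DERIV_exp
          DERIV_chain2[where f=artanh and g="\<lambda>t. c\<^sup>2 * exp t", OF artanh_real_has_field_derivative[OF r]])
    also have "2 / d * (1 / (1 - (c\<^sup>2 * exp t)\<^sup>2) * (c\<^sup>2 * exp t)) = hfun d (\<beta> t)"
      using sinh_2_artanh_real[OF r] d0 t assms(3)[of t] by (simp add: hfun_def)
    finally show ?thesis
      by (rule has_field_derivative_transform_within_open[OF _ open_lessThan t]) (simp add: assms(3))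
  qed
  \<comment> \<open>The parameter \<open>t\<close> is the logarithm of the radius, so the centre, where the map has \<open>\<alpha> = 0\<close>, is
  not reached.\<close>
  have \<beta>0: "\<beta> t \<noteq> 0" if t: "t \<in> ?I" for t
  proof
    assume "\<beta> t = 0"
    then have "artanh (c\<^sup>2 * exp t) = 0" using assms(3)[of t] t d0 by simp
    then show False using tanh_artanh_real[of "c\<^sup>2 * exp t"] \<rho>[OF t] by simp
  qed
  have stable: "equivariant_stable d (1 / c\<^sup>2) \<beta>"
    unfolding equivariant_stable_def
  proof (intro conjI allI impI biharm)
    fix K V assume "K \<subseteq> ?I" "test_function K (V :: real \<Rightarrow> real)" "\<exists>t. V t \<noteq> 0"
    then show "second_deriv_pos (\<lambda>s. E2 d K (\<lambda>t. \<beta> t + s * V t))"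
      using second_variation_pos[OF assms(2) open_lessThan \<beta>' \<beta>0] by (elim exE)
  qed
  have "conformal_diffeomorphism (hyp_metric d) ?B hyp_space (rot_map d \<beta>)"
    by (rule conformal_diffeomorphism_scaling[OF assms(2) c2 \<phi>])
  with proper stable show ?thesis by blast
qed

end
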